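(* Let $X\sim\mathrm{VG}(r,\theta,\sigma,0)$ with $r>0$, $\theta>0$ and $\sigma>0$, and let $M$ denote its mode. If $0<r\leq2$, then $M=0$. If $r>2$, then $M>0$ and $$\theta(r-3)<M<\theta(r-2),\qquad (A)$$ and also $$2\theta<\mathbb{E}[X]-M<3\theta.\qquad (B)$$ For $r>4$, $$M>\frac{\theta}{2}\bigg[r-2+\sqrt{\frac{\theta^2(r-2)^2+\sigma^2(r-4)^2}{\theta^2+\sigma^2}}\bigg],\qquad (C)$$ and the right-hand side of (C) is larger than the lower bound $\theta(r-3)$ of (A) for all $r>4$. There is equality in (C) if $r=4$, and the inequality (C) is reversed (strict $<$) if $2<r<4$. If $3<r<4$, then the right-hand side of (C) is smaller than the upper bound $\theta(r-2)$ of (A) (so the reversed inequality (C) improves on it), whereas for $2<r<3$ it is larger than $\theta(r-2)$. The lower and upper bounds in (A) are best possible amongst all bounds of the form $\theta(r-a)$, where $a\in\mathbb{R}$ does not involve the parameters: for no $a<3$ is $\theta(r-a)$ a lower bound for $M$ for all $r>2$, $\theta>0$, $\sigma>0$, and for no $a>2$ is $\theta(r-a)$ an upper bound for $M$ for all $r>2$, $\theta>0$, $\sigma>0$. Likewise, the lower and upper bounds in (B) are best possible amongst all bounds of the form $b\theta$, where $b\in\mathbb{R}$ does not involve the parameters: for no $b>2$ is $b\theta$ a lower bound, and for no $b<3$ is $b\theta$ an upper bound, for $\mathbb{E}[X]-M$ for all $r>2$, $\theta>0$, $\sigma>0$.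
   Context: For $\nu\in\mathbb{R}$ and $x>0$, $K_\nu(x)=\int_0^\infty \mathrm{e}^{-x\cosh t}\cosh(\nu t)\,\mathrm{d}t$ is the modified Bessel function of the second kind. Variance-gamma distribution: for $r>0$, $\theta\in\mathbb{R}$, $\sigma>0$, $X\sim\mathrm{VG}(r,\theta,\sigma,0)$ means that $X$ has density $$p(x) = \frac{1}{\sigma\sqrt{\pi}\, \Gamma(\frac{r}{2})}\, \mathrm{e}^{\theta x/\sigma^2} \bigg(\frac{|x|}{2\sqrt{\theta^2 + \sigma^2}}\bigg)^{\frac{r-1}{2}} K_{\frac{r-1}{2}}\bigg(\frac{\sqrt{\theta^2 + \sigma^2}}{\sigma^2} |x| \bigg),\qquad x\in\mathbb{R}$$ (at $x=0$ understood as a limit). The distribution is unimodal; its mode $M$ is the unique point at which the density attains its maximum (if the density is unbounded near $0$, the mode is $0$). *)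

theory Defs
  imports "HOL-Probability.Probability"
begin

definition bessel_K :: "real \<Rightarrow> real \<Rightarrow> real" where
  "bessel_K \<nu> x = (LBINT t:{0..}. exp (- x * cosh t) * cosh (\<nu> * t))"

text \<open>
  The closed formula of the variance-gamma density, meaningful for \<open>x \<noteq> 0\<close> only
  (the location parameter is \<open>0\<close> throughout).
\<close>

definition vg_formula :: "real \<Rightarrow> real \<Rightarrow> real \<Rightarrow> real \<Rightarrow> real" where
  "vg_formula r \<theta> \<sigma> x =
     1 / (\<sigma> * sqrt pi * Gamma (r / 2)) * exp (\<theta> * x / \<sigma>\<^sup>2)
     * (\<bar>x\<bar> / (2 * sqrt (\<theta>\<^sup>2 + \<sigma>\<^sup>2))) powr ((r - 1) / 2)
     * bessel_K ((r - 1) / 2) (sqrt (\<theta>\<^sup>2 + \<sigma>\<^sup>2) / \<sigma>\<^sup>2 * \<bar>x\<bar>)"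

text \<open>
  At \<open>0\<close> the density is the limit of the formula. For \<open>r \<le> 1\<close> that limit is infinite, so the
  value at \<open>0\<close> is unspecified there; it affects neither the law nor the mode below.
\<close>

definition vg_density :: "real \<Rightarrow> real \<Rightarrow> real \<Rightarrow> real \<Rightarrow> real" where
  "vg_density r \<theta> \<sigma> x =
     (if x = 0 then Lim (at 0) (vg_formula r \<theta> \<sigma>) else vg_formula r \<theta> \<sigma> x)"

definition vg_distributed :: "'a measure \<Rightarrow> ('a \<Rightarrow> real) \<Rightarrow> real \<Rightarrow> real \<Rightarrow> real \<Rightarrow> bool" where
  "vg_distributed P X r \<theta> \<sigma> \<longleftrightarrow>
     prob_space P \<and> distributed P lborel X (\<lambda>x. ennreal (vg_density r \<theta> \<sigma> x))"

text \<open>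
  The unique maximum point of the density, or \<open>0\<close> if the density is unbounded near \<open>0\<close>
  (\<open>Bfun f (at 0)\<close> says that \<open>f\<close> is bounded on some punctured neighbourhood of \<open>0\<close>).
\<close>

definition vg_mode :: "real \<Rightarrow> real \<Rightarrow> real \<Rightarrow> real" where
  "vg_mode r \<theta> \<sigma> =
     (if Bfun (vg_density r \<theta> \<sigma>) (at 0)
      then (THE m. \<forall>x. vg_density r \<theta> \<sigma> x \<le> vg_density r \<theta> \<sigma> m)
      else 0)"

definition vg_mode_bound :: "real \<Rightarrow> real \<Rightarrow> real \<Rightarrow> real" where
  "vg_mode_bound r \<theta> \<sigma> =
     \<theta> / 2 * (r - 2 + sqrt ((\<theta>\<^sup>2 * (r - 2)\<^sup>2 + \<sigma>\<^sup>2 * (r - 4)\<^sup>2) / (\<theta>\<^sup>2 + \<sigma>\<^sup>2)))"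

end

theory Submission
  imports Defs "HOL-Real_Asymp.Real_Asymp"
begin

text \<open>
  Put \<open>\<nu> = (r - 1) / 2\<close>, \<open>c = sqrt (\<theta>\<^sup>2 + \<sigma>\<^sup>2) / \<sigma>\<^sup>2\<close> and \<open>\<kappa> = \<theta> / sqrt (\<theta>\<^sup>2 + \<sigma>\<^sup>2)\<close>. Since
  \<open>(x\<^sup>\<nu> K\<^sub>\<nu>(x))' = - x\<^sup>\<nu> K\<^sub>\<nu>\<^sub>-\<^sub>1(x)\<close>, for \<open>r > 2\<close> the mode \<open>M\<close> is the root of \<open>R(c M) = \<kappa>\<close>, where
  \<open>R = K\<^sub>\<nu>\<^sub>-\<^sub>1 / K\<^sub>\<nu>\<close> increases strictly. Bounds for \<open>R\<close> by functions
  \<open>f(x) = x / (\<alpha> + sqrt (\<beta>\<^sup>2 + x\<^sup>2))\<close> turn into bounds for \<open>M\<close>, because \<open>f(y) = \<kappa>\<close> can be solved for \<open>y\<close>.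
  Such bounds follow from the Riccati equation \<open>R' = R\<^sup>2 + (2\<nu> - 1) R / x - 1\<close>: multiplied by an
  integrating factor, \<open>R - f\<close> tends to \<open>0\<close> at infinity and its derivative has the sign of the
  defect of \<open>f\<close> in that equation. Taking \<open>\<alpha> = \<beta> = \<nu> - 1/2\<close> and \<open>\<alpha> = \<beta> = \<nu> - 1\<close> gives (A), and
  \<open>\<alpha> = \<nu> - 1/2\<close>, \<open>\<beta> = \<nu> - 3/2\<close> gives (C).

  The mean \<open>r \<theta>\<close> comes from writing \<open>(c\<^sup>2 - (\<theta> / \<sigma>\<^sup>2)\<^sup>2) x p(x) - r (\<theta> / \<sigma>\<^sup>2) p(x)\<close> as a derivative, and
  (B) is then (A) again. All the constants are already optimal for \<open>r = 4\<close>, where \<open>M = \<theta> (1 + \<kappa>)\<close> and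
  \<open>\<kappa>\<close> takes every value in \<open>(0, 1)\<close>.
\<close>

section \<open>The modified Bessel function of the second kind\<close>

abbreviation bessel_integrand :: "real \<Rightarrow> real \<Rightarrow> real \<Rightarrow> real" where
  "bessel_integrand \<nu> x t \<equiv> exp (- (x * cosh t)) * cosh (\<nu> * t)"

lemma bessel_K_altdef: "bessel_K \<nu> x = (LBINT t:{0..}. bessel_integrand \<nu> x t)"
  by (simp add: bessel_K_def)

section \<open>Convergence, positivity and size of the Bessel integral\<close>

lemma cosh_ge_quadratic: "t\<^sup>2 / 4 \<le> cosh (t::real)"
proof -
  have *: "u\<^sup>2 / 4 \<le> cosh u" if "u \<ge> 0" for u :: real
  proof -
    have "exp u \<ge> 1 + u + u\<^sup>2 / 2" using that by (rule exp_lower_Taylor_quadratic)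
    moreover have "cosh u \<ge> exp u / 2" by (simp add: cosh_field_def)
    ultimately show ?thesis using that by simp
  qed
  show ?thesis using *[of "\<bar>t\<bar>"] by simp
qed

lemma cosh_le_exp_abs: "cosh (t::real) \<le> exp \<bar>t\<bar>"
proof -
  have "cosh \<bar>t\<bar> \<le> exp \<bar>t\<bar>" using sinh_plus_cosh[of "\<bar>t\<bar>"] sinh_real_nonneg_iff[of "\<bar>t\<bar>"] by linarith
  then show ?thesis by simp
qed

text \<open>The quadratic growth of \<open>cosh t\<close> beats the linear exponent
  \<open>\<bar>\<nu>\<bar> * t\<close>, and completing the square leaves a spare factor
  \<open>exp (- t)\<close>. The bound is an integrable majorant and also makes the boundary term at
  infinity vanish in \<open>bessel_K_recurrence\<close>.\<close>

lemma bessel_integrand_le: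
  assumes x: "x > 0" and t: "t \<ge> 0"
  shows "bessel_integrand \<nu> x t \<le> exp ((\<bar>\<nu>\<bar> + 1)\<^sup>2 / x) * exp (- t)"
proof -
  have "bessel_integrand \<nu> x t \<le> exp (- (x * cosh t)) * exp (\<bar>\<nu>\<bar> * t)"
    using cosh_le_exp_abs[of "\<nu> * t"] t by (intro mult_left_mono) (auto simp: abs_mult)
  also have "\<dots> = exp (\<bar>\<nu>\<bar> * t - (x * cosh t))" by (simp add: exp_add[symmetric])
  also have "\<dots> \<le> exp ((\<bar>\<nu>\<bar> + 1)\<^sup>2 / x - t)"
  proof -
    have "x * (t\<^sup>2 / 4) \<le> x * cosh t" using cosh_ge_quadratic x by (intro mult_left_mono) auto
    moreover have "(\<bar>\<nu>\<bar> + 1) * t \<le> (\<bar>\<nu>\<bar> + 1)\<^sup>2 / x + x * (t\<^sup>2 / 4)"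
    proof -
      have "0 \<le> ((\<bar>\<nu>\<bar> + 1) - x * t / 2)\<^sup>2 / x" using x by simp
      also have "\<dots> = (\<bar>\<nu>\<bar> + 1)\<^sup>2 / x + x * (t\<^sup>2 / 4) - (\<bar>\<nu>\<bar> + 1) * t"
        using x by (simp add: power2_eq_square field_simps)
      finally show ?thesis by simp
    qed
    ultimately show ?thesis by (simp add: algebra_simps)
  qed
  also have "\<dots> = exp ((\<bar>\<nu>\<bar> + 1)\<^sup>2 / x) * exp (- t)" by (simp add: exp_add[symmetric])
  finally show ?thesis .
qed

lemma set_integrable_exp_minus: "set_integrable lborel {0..} (\<lambda>t::real. exp (- t))"
proof -
  have "integrable lborel (\<lambda>t. t ^ 0 * exp (- t) * indicator {0..} (t::real))"
    using has_bochner_integral_I0i_power_exp_m'[of 0] by (rule has_bochner_integral_iff[THEN iffD1, THEN conjunct1])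
  then show ?thesis unfolding set_integrable_def
    by (simp add: mult.commute)
qed

lemma bessel_integrable [intro]:
  assumes "x > 0"
  shows "set_integrable lborel {0..} (bessel_integrand \<nu> x)"
proof (rule set_integrable_bound)
  show "set_integrable lborel {0..} (\<lambda>t. exp ((\<bar>\<nu>\<bar> + 1)\<^sup>2 / x) * exp (- t))"
    by (intro set_integrable_mult_right set_integrable_exp_minus)
  have "bessel_integrand \<nu> x \<in> borel_measurable lborel"
    by (simp, intro borel_measurable_continuous_onI continuous_intros)
  then show "set_borel_measurable lborel {0..} (bessel_integrand \<nu> x)"
    unfolding set_borel_measurable_def by measurable
  show "AE t in lborel. t \<in> {0..} \<longrightarrow> norm (bessel_integrand \<nu> x t) \<le> norm (exp ((\<bar>\<nu>\<bar> + 1)\<^sup>2 / x) * exp (- t))"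
    using bessel_integrand_le[OF assms] by auto
qed

lemma bessel_K_minus: "bessel_K (- \<nu>) x = bessel_K \<nu> x"
  by (simp add: bessel_K_altdef)

text \<open>A nonnegative difference with integral 0 would vanish almost everywhere, yet it is
  positive on \<open>{1..2}\<close>, which has positive measure. The strictness here is what makes
  \<open>bessel_K\<close> positive and strictly monotone in the modulus of the order.\<close>

lemma set_integral_less:
  fixes f g :: "real \<Rightarrow> real"
  assumes f: "set_integrable lborel {0..} f" and g: "set_integrable lborel {0..} g"
    and le: "\<And>t. t > 0 \<Longrightarrow> f t < g t"
  shows "(LBINT t:{0..}. f t) < (LBINT t:{0..}. g t)"
proof -
  let ?h = "\<lambda>t. indicat_real {0..} t *\<^sub>R (g t - f t)"
  have int: "integrable lborel ?h"
    using set_integral_diff(1)[OF g f] by (simp add: set_integrable_def)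
  have nonneg: "AE t in lborel. 0 \<le> ?h t"
    using AE_lborel_singleton[of 0]
  proof eventually_elim
    case (elim t)
    then show ?case using le[of t] by (cases "t > 0") (auto simp: indicator_def)
  qed
  have "(\<integral>t. ?h t \<partial>lborel) \<noteq> 0"
  proof
    assume "(\<integral>t. ?h t \<partial>lborel) = 0"
    then have "AE t in lborel. ?h t = 0" using integral_nonneg_eq_0_iff_AE[OF int nonneg] by simp
    then have "AE t in lborel. t \<notin> {1..2::real}"
    proof eventually_elim
      case (elim t)
      then show ?case using le[of t] by (auto simp: indicator_def)
    qed
    then have "emeasure lborel {1..2::real} = 0"
      by (subst (asm) AE_iff_measurable[where N = "{1..2}"]) auto
    then show False by simp
  qed
  moreover have "(\<integral>t. ?h t \<partial>lborel) \<ge> 0" using nonneg by (rule integral_nonneg_AE)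
  moreover have "(\<integral>t. ?h t \<partial>lborel) = (LBINT t:{0..}. g t) - (LBINT t:{0..}. f t)"
    using set_integral_diff(2)[OF g f] by (simp add: set_lebesgue_integral_def)
  ultimately show ?thesis by simp
qed

lemma bessel_K_pos: assumes "x > 0" shows "bessel_K \<nu> x > 0"
  using set_integral_less[of "\<lambda>_. 0" "bessel_integrand \<nu> x"] bessel_integrable[OF assms]
  by (simp add: bessel_K_altdef set_integrable_def set_lebesgue_integral_def)

lemma bessel_K_strict_mono:
  assumes x: "x > 0" and "\<bar>\<mu>\<bar> < \<bar>\<nu>\<bar>"
  shows "bessel_K \<mu> x < bessel_K \<nu> x"
  unfolding bessel_K_altdef
proof (rule set_integral_less)
  fix t :: real assume t: "t > 0"
  have "\<bar>\<mu> * t\<bar> < \<bar>\<nu> * t\<bar>" using assms t by (simp add: abs_mult)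
  then have "cosh \<bar>\<mu> * t\<bar> < cosh \<bar>\<nu> * t\<bar>" by (subst cosh_real_nonneg_less_iff) auto
  then show "bessel_integrand \<mu> x t < bessel_integrand \<nu> x t" by simp
qed (rule bessel_integrable[OF x])+

text \<open>Since \<open>cosh t \<ge> 1\<close>, passing from \<open>x0\<close> to \<open>x\<close>
  costs the integrand at least the factor \<open>exp (- (x - x0))\<close>, uniformly in
  \<open>t\<close>.\<close>

lemma bessel_K_decay:
  assumes x0: "x0 > 0" and x: "x0 \<le> x"
  shows "bessel_K \<nu> x \<le> exp (- (x - x0)) * bessel_K \<nu> x0"
proof -
  have "bessel_K \<nu> x \<le> (LBINT t:{0..}. exp (- (x - x0)) * bessel_integrand \<nu> x0 t)"
    unfolding bessel_K_altdef
  proof (rule set_integral_mono)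
    fix t :: real
    have "(x - x0) * 1 \<le> (x - x0) * cosh t" using x cosh_real_ge_1 by (intro mult_left_mono) auto
    then have "- (x * cosh t) \<le> - (x - x0) + - (x0 * cosh t)" by (simp add: algebra_simps)
    then have "exp (- (x * cosh t)) \<le> exp (- (x - x0)) * exp (- (x0 * cosh t))"
      by (subst exp_add[symmetric]) simp
    from mult_right_mono[OF this, of "cosh (\<nu> * t)"]
    show "bessel_integrand \<nu> x t \<le> exp (- (x - x0)) * bessel_integrand \<nu> x0 t"
      by (simp add: algebra_simps)
  qed (use assms in \<open>auto intro!: set_integrable_mult_right\<close>)
  also have "\<dots> = exp (- (x - x0)) * bessel_K \<nu> x0" by (simp add: bessel_K_altdef)
  finally show ?thesis .
qed

text \<open>Cut the integral off at \<open>T\<close>. As \<open>x\<close> tends to 0 the bound tends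
  to the arbitrary number \<open>T\<close>, so \<open>bessel_K \<nu>\<close> is unbounded near 0 for
  every order.\<close>

lemma bessel_K_lower:
  assumes x: "x > 0" and T: "T \<ge> 0"
  shows "T * exp (- (x * cosh T)) \<le> bessel_K \<nu> x"
proof -
  have "T * exp (- (x * cosh T)) = (LBINT t:{0..T}. exp (- (x * cosh T)))"
    using T by (simp add: set_lebesgue_integral_def)
  also have "\<dots> \<le> (LBINT t:{0..T}. bessel_integrand \<nu> x t)"
  proof (rule set_integral_mono)
    show "set_integrable lborel {0..T} (bessel_integrand \<nu> x)"
      by (rule set_integrable_subset[OF bessel_integrable[OF x]]) auto
    fix t assume t: "t \<in> {0..T}"
    have "cosh t \<le> cosh T" using t T by (subst cosh_real_nonneg_le_iff) auto
    then have "exp (- (x * cosh T)) * 1 \<le> exp (- (x * cosh t)) * cosh (\<nu> * t)"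
      using x cosh_real_ge_1 by (intro mult_mono) auto
    then show "exp (- (x * cosh T)) \<le> bessel_integrand \<nu> x t" by simp
  qed (use T in \<open>auto simp: set_integrable_def\<close>)
  also have "\<dots> \<le> bessel_K \<nu> x"
    unfolding bessel_K_altdef set_lebesgue_integral_def
  proof (rule integral_mono)
    show "integrable lborel (\<lambda>t. indicat_real {0..} t *\<^sub>R bessel_integrand \<nu> x t)"
      using bessel_integrable[OF x] by (simp add: set_integrable_def)
    have "set_integrable lborel {0..T} (bessel_integrand \<nu> x)"
      by (rule set_integrable_subset[OF bessel_integrable[OF x]]) auto
    then show "integrable lborel (\<lambda>t. indicat_real {0..T} t *\<^sub>R bessel_integrand \<nu> x t)"
      by (simp add: set_integrable_def)
  qed (auto simp: indicator_def)
  finally show ?thesis .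
qed

section \<open>Differentiation under the integral sign and the recurrence in the order\<close>

lemma set_integral_abs_le:
  fixes f g :: "real \<Rightarrow> real"
  assumes f: "set_integrable lborel A f" and g: "set_integrable lborel A g"
    and le: "\<And>t. \<bar>f t\<bar> \<le> g t"
  shows "\<bar>LBINT t:A. f t\<bar> \<le> (LBINT t:A. g t)"
proof -
  have "\<bar>LBINT t:A. f t\<bar> \<le> (LBINT t:A. \<bar>f t\<bar>)"
    using set_integral_norm_bound[OF f] by simp
  also have "\<dots> \<le> (LBINT t:A. g t)"
    by (rule set_integral_mono[OF set_integrable_abs[OF f] g le])
  finally show ?thesis .
qed

text \<open>Both directions come from \<open>exp y \<ge> 1 + y\<close>, taken at
  \<open>y = - u\<close> and at \<open>y = u\<close>. This is the pointwise remainder estimate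
  behind the derivative of \<open>bessel_K\<close>.\<close>

lemma exp_minus_quadratic_bound: "\<bar>exp (- u) - 1 + u\<bar> \<le> u\<^sup>2 * exp \<bar>u\<bar>" for u :: real
proof -
  have low: "1 - u \<le> exp (- u)" using exp_ge_add_one_self[of "- u"] by simp
  have "1 + u \<le> exp u" by (rule exp_ge_add_one_self)
  then have "(1 + u) * exp (- u) \<le> exp u * exp (- u)" by (intro mult_right_mono) auto
  then have up: "exp (- u) - 1 + u \<le> u * (1 - exp (- u))" by (simp add: exp_minus algebra_simps)
  have "u * (1 - exp (- u)) \<le> u\<^sup>2 * exp \<bar>u\<bar>"
  proof (cases "u \<ge> 0")
    case True
    have "u * (1 - exp (- u)) \<le> u * (u * 1)" using low True by (intro mult_left_mono) auto
    also have "\<dots> \<le> u * (u * exp \<bar>u\<bar>)" using True by (intro mult_left_mono) auto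
    finally show ?thesis by (simp add: power2_eq_square mult.assoc)
  next
    case False
    have "exp (- u) - 1 \<le> - u * exp (- u)" using up False low by (simp add: algebra_simps)
    then have "- u * (exp (- u) - 1) \<le> - u * (- u * exp (- u))" using False by (intro mult_left_mono) auto
    then show ?thesis using False by (simp add: power2_eq_square algebra_simps)
  qed
  then show ?thesis using low up by linarith
qed

text \<open>With an explicit quadratic remainder, differentiating under the integral reduces to
  integrating one pointwise estimate.\<close>

lemma DERIV_quadratic_remainder:
  fixes f :: "real \<Rightarrow> real"
  assumes d: "d > 0" and q: "\<And>h. \<bar>h\<bar> \<le> d \<Longrightarrow> \<bar>f (x + h) - f x - h * D\<bar> \<le> C * h\<^sup>2"
  shows "DERIV f x :> D"
  unfolding DERIV_def
proof (rule LIM_zero_cancel, rule tendsto_0_le[where K=1])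
  show "((\<lambda>h. C * h) \<longlongrightarrow> 0) (at 0)" by (auto intro!: tendsto_eq_intros)
  have "\<forall>\<^sub>F h in at 0. h \<in> {-d<..<d} - {0}"
    using d by (intro eventually_at_in_open) auto
  then show "\<forall>\<^sub>F h in at 0. norm ((f (x + h) - f x) / h - D) \<le> norm (C * h) * 1"
  proof eventually_elim
    case (elim h)
    then have h: "h \<noteq> 0" "\<bar>h\<bar> \<le> d" by auto
    have "C * h\<^sup>2 \<ge> 0" using q[OF h(2)] by linarith
    then have C: "C \<ge> 0" using h by (simp add: zero_le_mult_iff)
    have "\<bar>(f (x + h) - f x) / h - D\<bar> = \<bar>f (x + h) - f x - h * D\<bar> / \<bar>h\<bar>"
      using h by (simp flip: abs_divide add: field_simps)
    also have "\<dots> \<le> C * h\<^sup>2 / \<bar>h\<bar>" using q[OF h(2)] by (intro divide_right_mono) auto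
    also have "\<dots> = C * \<bar>h\<bar>" using h by (simp add: power2_eq_square abs_if)
    finally show ?case using C by (simp add: abs_mult)
  qed
qed

lemma cosh_mult_cosh: "cosh t * cosh (\<nu> * t) = (cosh ((\<nu> + 1) * t) + cosh ((\<nu> - 1) * t)) / 2" for t :: real
  by (simp add: cosh_add cosh_diff algebra_simps)

lemma sinh_mult_sinh: "sinh t * sinh (\<nu> * t) = (cosh ((\<nu> + 1) * t) - cosh ((\<nu> - 1) * t)) / 2" for t :: real
  by (simp add: cosh_add cosh_diff algebra_simps)

lemma bessel_integrand_cosh:
  "cosh t * bessel_integrand \<nu> x t = (bessel_integrand (\<nu> + 1) x t + bessel_integrand (\<nu> - 1) x t) / 2"
proof -
  have "cosh t * bessel_integrand \<nu> x t = exp (- (x * cosh t)) * (cosh t * cosh (\<nu> * t))" by simp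
  then show ?thesis unfolding cosh_mult_cosh by (simp only: distrib_left times_divide_eq_right)
qed

lemma bessel_cosh_integral:
  assumes "x > 0"
  shows "set_integrable lborel {0..} (\<lambda>t. cosh t * bessel_integrand \<nu> x t)"
    and "(LBINT t:{0..}. cosh t * bessel_integrand \<nu> x t) = (bessel_K (\<nu> + 1) x + bessel_K (\<nu> - 1) x) / 2"
  unfolding bessel_integrand_cosh bessel_K_altdef using bessel_integrable[OF assms]
  by (simp_all add: set_integral_add)

lemma bessel_cosh2_integrable:
  assumes "x > 0"
  shows "set_integrable lborel {0..} (\<lambda>t. (cosh t)\<^sup>2 * bessel_integrand \<nu> x t)"
proof -
  have "(\<lambda>t. (cosh t)\<^sup>2 * bessel_integrand \<nu> x t) =
     (\<lambda>t. (cosh t * bessel_integrand (\<nu> + 1) x t + cosh t * bessel_integrand (\<nu> - 1) x t) / 2)"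
  proof
    fix t
    have "(cosh t)\<^sup>2 * bessel_integrand \<nu> x t = cosh t * (cosh t * bessel_integrand \<nu> x t)"
      by (simp add: power2_eq_square)
    then show "(cosh t)\<^sup>2 * bessel_integrand \<nu> x t =
        (cosh t * bessel_integrand (\<nu> + 1) x t + cosh t * bessel_integrand (\<nu> - 1) x t) / 2"
      by (simp only: bessel_integrand_cosh[of t x \<nu>] distrib_left times_divide_eq_right)
  qed
  then show ?thesis using bessel_cosh_integral(1)[OF assms] by (simp add: set_integral_add)
qed

text \<open>Differentiating the integrand produces the factor \<open>- cosh t\<close>, which the
  product formula for \<open>cosh\<close> turns into the orders \<nu> + 1 and \<nu> - 1. For
  \<open>\<bar>h\<bar> \<le> x / 2\<close> the remainder loses at most half of the exponent
  \<open>x * cosh t\<close>, so it is dominated by \<open>h\<^sup>2 * (cosh t)\<^sup>2\<close> times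
  the integrand at \<open>x / 2\<close>.\<close>

lemma bessel_K_DERIV_aux:
  assumes x: "x > 0"
  shows "DERIV (bessel_K \<nu>) x :> - (bessel_K (\<nu> + 1) x + bessel_K (\<nu> - 1) x) / 2"
proof (rule DERIV_quadratic_remainder[where d = "x / 2"])
  let ?G = "\<lambda>t. (cosh t)\<^sup>2 * bessel_integrand \<nu> (x / 2) t"
  define C where "C = (LBINT t:{0..}. ?G t)"
  fix h :: real assume h: "\<bar>h\<bar> \<le> x / 2"
  then have xh: "x + h > 0" using x by linarith
  let ?I = "bessel_integrand \<nu>"
  let ?D = "\<lambda>t. ?I (x + h) t - ?I x t + h * (cosh t * ?I x t)"
  have int: "set_integrable lborel {0..} ?D"
    using bessel_integrable[OF x] bessel_integrable[OF xh] bessel_cosh_integral(1)[OF x]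
    by (intro set_integral_add set_integral_diff) auto
  have "x / 2 > 0" using x by simp
  note G = set_integrable_mult_right[OF bessel_cosh2_integrable[OF this, of \<nu>], of "h\<^sup>2"]
  have pt: "\<bar>?D t\<bar> \<le> h\<^sup>2 * ?G t" for t
  proof -
    have "?D t = ?I x t * (exp (- (h * cosh t)) - 1 + h * cosh t)"
      by (simp add: algebra_simps exp_add exp_diff exp_minus divide_inverse)
    then have "\<bar>?D t\<bar> = ?I x t * \<bar>exp (- (h * cosh t)) - 1 + h * cosh t\<bar>" by (simp add: abs_mult)
    also have "\<dots> \<le> ?I x t * ((h * cosh t)\<^sup>2 * exp \<bar>h * cosh t\<bar>)"
      by (intro mult_left_mono exp_minus_quadratic_bound) auto
    also have "\<dots> = (h * cosh t)\<^sup>2 * cosh (\<nu> * t) * exp (- (x * cosh t) + \<bar>h\<bar> * cosh t)"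
      by (simp only: exp_add abs_mult) simp
    also have "\<dots> \<le> (h * cosh t)\<^sup>2 * cosh (\<nu> * t) * exp (- (x / 2 * cosh t))"
    proof -
      have "\<bar>h\<bar> * cosh t \<le> x / 2 * cosh t" using h by (intro mult_right_mono) auto
      then show ?thesis by (intro mult_left_mono) (auto simp: algebra_simps)
    qed
    finally show ?thesis by (simp add: power_mult_distrib algebra_simps)
  qed
  have "bessel_K \<nu> (x + h) - bessel_K \<nu> x - h * (- (bessel_K (\<nu> + 1) x + bessel_K (\<nu> - 1) x) / 2)
      = (LBINT t:{0..}. ?I (x + h) t) - (LBINT t:{0..}. ?I x t) + h * (LBINT t:{0..}. cosh t * ?I x t)"
    unfolding bessel_cosh_integral(2)[OF x] bessel_K_altdef[symmetric]
    by (metis diff_minus_eq_add minus_divide_left mult_minus_right)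
  then have eq: "bessel_K \<nu> (x + h) - bessel_K \<nu> x - h * (- (bessel_K (\<nu> + 1) x + bessel_K (\<nu> - 1) x) / 2)
      = (LBINT t:{0..}. ?D t)"
    by (simp add: set_integral_add(2) set_integral_diff(1,2)
        bessel_integrable[OF x] bessel_integrable[OF xh] bessel_cosh_integral(1)[OF x])
  have "\<bar>LBINT t:{0..}. ?D t\<bar> \<le> (LBINT t:{0..}. h\<^sup>2 * ?G t)"
    by (rule set_integral_abs_le[OF int G pt])
  then show "\<bar>bessel_K \<nu> (x + h) - bessel_K \<nu> x - h * (- (bessel_K (\<nu> + 1) x + bessel_K (\<nu> - 1) x) / 2)\<bar> \<le> C * h\<^sup>2"
    unfolding eq C_def set_integral_mult_right by (simp only: mult.commute)
qed (use x in auto)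

text \<open>Integrate the derivative of \<open>exp (- (x * cosh t)) * sinh (\<nu> * t)\<close> over
  the half-line. Both boundary values are 0, and the product
  \<open>sinh t * sinh (\<nu> * t)\<close> splits into the two neighbouring orders.\<close>

lemma bessel_K_recurrence:
  assumes x: "x > 0"
  shows "bessel_K (\<nu> + 1) x - bessel_K (\<nu> - 1) x = 2 * \<nu> / x * bessel_K \<nu> x"
proof -
  let ?I = "\<lambda>\<nu>. bessel_integrand \<nu> x"
  let ?f = "\<lambda>t. \<nu> * ?I \<nu> t - x / 2 * (?I (\<nu> + 1) t - ?I (\<nu> - 1) t)"
  let ?F = "\<lambda>t. exp (- (x * cosh t)) * sinh (\<nu> * t)"
  have int: "set_integrable lborel {0..} ?f"
    using bessel_integrable[OF x] by (intro set_integral_diff set_integrable_mult_right) auto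
  have "(LBINT t=ereal 0..\<infinity>. ?f t) = 0 - 0"
  proof (rule interval_integral_FTC_integrable)
    fix t
    have "(?F has_real_derivative ?f t) (at t)"
    proof -
      have "(?F has_real_derivative (\<nu> * ?I \<nu> t - x * (exp (- (x * cosh t)) * (sinh t * sinh (\<nu> * t))))) (at t)"
        by (auto intro!: derivative_eq_intros simp: algebra_simps)
      moreover have "\<nu> * ?I \<nu> t - x * (exp (- (x * cosh t)) * (sinh t * sinh (\<nu> * t))) = ?f t"
        unfolding sinh_mult_sinh by (simp only: right_diff_distrib times_divide_eq_right times_divide_eq_left diff_divide_distrib)
      ultimately show ?thesis by simp
    qed
    then show "(?F has_vector_derivative ?f t) (at t)"
      by (simp add: has_real_derivative_iff_has_vector_derivative)
    show "isCont ?f t" by (intro continuous_intros)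
  next
    show "set_integrable lborel (einterval (ereal 0) \<infinity>) ?f"
      by (rule set_integrable_subset[OF int]) auto
    have "isCont ?F 0" by (intro continuous_intros)
    then have "(?F \<longlongrightarrow> 0) (at_right 0)" by (simp add: isCont_def filterlim_at_split)
    then show "((?F \<circ> real_of_ereal) \<longlongrightarrow> 0) (at_right (ereal 0))" by (simp only: ereal_tendsto_simps1)
    have "(?F \<longlongrightarrow> 0) at_top"
    proof (rule tendsto_0_le[where K=1])
      show "((\<lambda>t. exp ((\<bar>\<nu>\<bar> + 1)\<^sup>2 / x) * exp (- t)) \<longlongrightarrow> 0) at_top" by real_asymp
      show "\<forall>\<^sub>F t in at_top. norm (?F t) \<le> norm (exp ((\<bar>\<nu>\<bar> + 1)\<^sup>2 / x) * exp (- t)) * 1"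
        using eventually_ge_at_top[of 0]
      proof eventually_elim
        case (elim t)
        have "\<bar>sinh (\<nu> * t)\<bar> \<le> cosh (\<nu> * t)"
          using sinh_le_cosh_real[of "\<nu> * t"] sinh_le_cosh_real[of "- (\<nu> * t)"] by simp
        then have "\<bar>?F t\<bar> \<le> ?I \<nu> t" by (simp add: abs_mult)
        with bessel_integrand_le[OF x elim, of \<nu>] show ?case by simp
      qed
    qed
    then show "((?F \<circ> real_of_ereal) \<longlongrightarrow> 0) (at_left \<infinity>)" by (simp only: ereal_tendsto_simps1)
  qed auto
  moreover have "(LBINT t=ereal 0..\<infinity>. ?f t) = (LBINT t:{0..}. ?f t)"
    unfolding interval_integral_to_infinity_eq
    by (rule set_integral_discrete_difference[where X="{0}"]) auto
  moreover have "(LBINT t:{0..}. ?f t) = \<nu> * bessel_K \<nu> x - x / 2 * (bessel_K (\<nu> + 1) x - bessel_K (\<nu> - 1) x)"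
    unfolding bessel_K_altdef
    by (simp add: set_integral_diff set_integrable_mult_right bessel_integrable[OF x])
  ultimately show ?thesis using x by (simp add: field_simps)
qed

lemma bessel_K_DERIV:
  assumes x: "x > 0"
  shows "DERIV (bessel_K \<nu>) x :> - bessel_K (\<nu> - 1) x - \<nu> / x * bessel_K \<nu> x"
proof -
  have "- (bessel_K (\<nu> + 1) x + bessel_K (\<nu> - 1) x) / 2 = - bessel_K (\<nu> - 1) x - \<nu> / x * bessel_K \<nu> x"
    using bessel_K_recurrence[OF x, of \<nu>] by (simp add: field_simps)
  with bessel_K_DERIV_aux[OF x, of \<nu>] show ?thesis by (simp only:)
qed

lemma bessel_K_powr_DERIV:
  assumes x: "x > 0"
  shows "DERIV (\<lambda>x. x powr \<nu> * bessel_K \<nu> x) x :> - (x powr \<nu> * bessel_K (\<nu> - 1) x)"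
proof -
  have "x powr (\<nu> - 1) = x powr \<nu> / x" using x by (simp add: powr_diff)
  with DERIV_mult[OF has_real_derivative_powr[OF x, of \<nu>] bessel_K_DERIV[OF x, of \<nu>]] x
  show ?thesis by (simp add: algebra_simps)
qed

text \<open>As \<open>bessel_K\<close> is even in its order, this is
  \<open>bessel_K_powr_DERIV\<close> at order 1 - \<nu>.\<close>

lemma bessel_K_powr_DERIV':
  assumes x: "x > 0"
  shows "DERIV (\<lambda>x. x powr (1 - \<nu>) * bessel_K (\<nu> - 1) x) x :> - (x powr (1 - \<nu>) * bessel_K \<nu> x)"
proof -
  have "bessel_K (1 - \<nu>) = bessel_K (\<nu> - 1)" using bessel_K_minus[of "\<nu> - 1"] by auto
  moreover have "bessel_K (1 - \<nu> - 1) = bessel_K \<nu>" using bessel_K_minus[of "\<nu>"] by auto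
  ultimately show ?thesis using bessel_K_powr_DERIV[OF x, of "1 - \<nu>"] by simp
qed

section \<open>Bounds for ratios of Bessel functions\<close>

definition amos :: "real \<Rightarrow> real \<Rightarrow> real \<Rightarrow> real" where
  "amos \<alpha> \<beta> x = x / (\<alpha> + sqrt (\<beta>\<^sup>2 + x\<^sup>2))"

definition amos_primitive :: "real \<Rightarrow> real \<Rightarrow> real \<Rightarrow> real" where
  "amos_primitive \<alpha> \<beta> x = sqrt (\<beta>\<^sup>2 + x\<^sup>2) - \<alpha> * ln (\<alpha> + sqrt (\<beta>\<^sup>2 + x\<^sup>2))"

lemma amos_pos:
  assumes "\<alpha> \<ge> 0" "x > 0"
  shows "amos \<alpha> \<beta> x > 0"
  using assms by (auto simp: amos_def intro!: divide_pos_pos add_nonneg_pos add_nonneg_pos)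

lemma amos_le_1:
  assumes "\<alpha> \<ge> 0" "x > 0"
  shows "amos \<alpha> \<beta> x \<le> 1"
proof -
  have "x \<le> sqrt (\<beta>\<^sup>2 + x\<^sup>2)" by (rule real_le_rsqrt) simp
  then have "x \<le> \<alpha> + sqrt (\<beta>\<^sup>2 + x\<^sup>2)" "\<alpha> + sqrt (\<beta>\<^sup>2 + x\<^sup>2) > 0" using assms by linarith+
  then show ?thesis by (simp add: amos_def divide_le_eq_1)
qed

lemma sqrt_DERIV:
  assumes x: "x > 0"
  shows "DERIV (\<lambda>x. sqrt (\<beta>\<^sup>2 + x\<^sup>2)) x :> x / sqrt (\<beta>\<^sup>2 + x\<^sup>2)"
proof -
  have "\<beta>\<^sup>2 + x\<^sup>2 > 0" using x by (intro add_nonneg_pos) auto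
  then show ?thesis by (auto intro!: derivative_eq_intros simp: field_simps)
qed

lemma amos_DERIV:
  fixes \<alpha> \<beta> x :: real
  assumes "\<alpha> \<ge> 0" "x > 0"
  defines "s \<equiv> sqrt (\<beta>\<^sup>2 + x\<^sup>2)"
  shows "DERIV (amos \<alpha> \<beta>) x :> (\<alpha> + \<beta>\<^sup>2 / s) / (\<alpha> + s)\<^sup>2"
proof -
  have s: "s > 0" "s\<^sup>2 = \<beta>\<^sup>2 + x\<^sup>2" using assms by (auto simp: s_def add_nonneg_pos)
  have "DERIV (\<lambda>x. x / (\<alpha> + sqrt (\<beta>\<^sup>2 + x\<^sup>2))) x :> ((\<alpha> + s) - x * (x / s)) / ((\<alpha> + s) * (\<alpha> + s))"
    using DERIV_divide[OF DERIV_ident DERIV_add[OF DERIV_const sqrt_DERIV[OF assms(2), of \<beta>]], of \<alpha>] assms(1) s(1)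
    by (simp add: s_def[symmetric])
  also have "(\<alpha> + s) - x * (x / s) = \<alpha> + \<beta>\<^sup>2 / s"
    using s by (simp add: field_simps power2_eq_square)
  finally show ?thesis by (simp add: amos_def[abs_def] power2_eq_square)
qed

lemma amos_primitive_DERIV:
  assumes "\<alpha> \<ge> 0" "x > 0"
  shows "DERIV (amos_primitive \<alpha> \<beta>) x :> amos \<alpha> \<beta> x"
proof -
  define s where "s = sqrt (\<beta>\<^sup>2 + x\<^sup>2)"
  have s: "s > 0" using assms by (auto simp: s_def add_nonneg_pos)
  have "DERIV (amos_primitive \<alpha> \<beta>) x :> x / s - \<alpha> * (x / s / (\<alpha> + s))"
  proof -
    have "DERIV (\<lambda>x. \<alpha> + sqrt (\<beta>\<^sup>2 + x\<^sup>2)) x :> x / s"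
      using DERIV_add[OF DERIV_const sqrt_DERIV[OF assms(2), of \<beta>], of \<alpha>] by (simp add: s_def)
    moreover have "\<alpha> + sqrt (\<beta>\<^sup>2 + x\<^sup>2) > 0" using assms(1) s unfolding s_def by linarith
    ultimately have "DERIV (\<lambda>x. ln (\<alpha> + sqrt (\<beta>\<^sup>2 + x\<^sup>2))) x :> 1 / (\<alpha> + s) * (x / s)"
      unfolding s_def by (rule DERIV_chain2[OF DERIV_ln_divide, rotated])
    then
    have "DERIV (\<lambda>x. ln (\<alpha> + sqrt (\<beta>\<^sup>2 + x\<^sup>2))) x :> x / s / (\<alpha> + s)"
      by (simp add: mult.commute)
    from DERIV_diff[OF sqrt_DERIV[OF assms(2), of \<beta>] DERIV_cmult[OF this, of \<alpha>]]
    show ?thesis by (simp add: amos_primitive_def[abs_def] s_def)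
  qed
  also have "x / s - \<alpha> * (x / s / (\<alpha> + s)) = amos \<alpha> \<beta> x"
  proof -
    have "\<alpha> + s \<noteq> 0" using assms(1) s by linarith
    then show ?thesis using s by (simp add: amos_def s_def[symmetric] divide_simps) (simp add: algebra_simps)
  qed
  finally show ?thesis .
qed

lemma bessel_K_lt_shift:
  assumes "\<nu> > 1/2" "x > 0"
  shows "bessel_K (\<nu> - 1) x < bessel_K \<nu> x"
  using assms by (intro bessel_K_strict_mono) auto

text \<open>
  The excess \<open>f\<^sup>2 + (2\<nu> - 1) f / x - 1 - f'\<close> of \<open>f = amos \<alpha> \<beta>\<close> in the Riccati equation of
  \<open>K\<^sub>\<nu>\<^sub>-\<^sub>1 / K\<^sub>\<nu>\<close>, over a common denominator.
\<close>

definition amos_defect :: "real \<Rightarrow> real \<Rightarrow> real \<Rightarrow> real \<Rightarrow> real" where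
  "amos_defect \<nu> \<alpha> \<beta> x =
     (let s = sqrt (\<beta>\<^sup>2 + x\<^sup>2) in
      ((2 * \<nu> - 1 - 2 * \<alpha>) * s + (2 * \<nu> - 1) * \<alpha> - \<alpha>\<^sup>2 - \<beta>\<^sup>2 - \<alpha> - \<beta>\<^sup>2 / s) / (\<alpha> + s)\<^sup>2)"

text \<open>
  The factors around the bracket make the derivative a positive multiple of the defect: with
  \<open>D = K\<^sub>\<nu>\<^sub>-\<^sub>1 / K\<^sub>\<nu> - f\<close>, the function \<open>x powr (1 - \<nu>) * K\<^sub>\<nu> * exp (- \<integral>f)\<close> is an integrating
  factor of the linear equation for \<open>D\<close>.
\<close>

definition amos_gap :: "real \<Rightarrow> real \<Rightarrow> real \<Rightarrow> real \<Rightarrow> real" where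
  "amos_gap \<nu> \<alpha> \<beta> x =
     x powr (1 - \<nu>) * (bessel_K (\<nu> - 1) x - amos \<alpha> \<beta> x * bessel_K \<nu> x) * exp (- amos_primitive \<alpha> \<beta> x)"

text \<open>Write B and G for \<open>x powr (1 - \<nu>)\<close> times the Bessel functions of order
  \<nu> - 1 and \<nu>, and f for \<open>amos \<alpha> \<beta>\<close>. Then B' = - G and G' = - B -
  (2\<nu> - 1) G / x. In the derivative of (B - f G) exp(- P), where P' = f, the terms in B cancel,
  and what remains is G exp(- P) times the Riccati excess of f.\<close>

lemma amos_gap_DERIV:
  assumes \<alpha>: "\<alpha> \<ge> 0" and x: "x > 0"
  shows "DERIV (amos_gap \<nu> \<alpha> \<beta>) x :>
    x powr (1 - \<nu>) * bessel_K \<nu> x * exp (- amos_primitive \<alpha> \<beta> x) * amos_defect \<nu> \<alpha> \<beta> x"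
proof -
  define s where "s = sqrt (\<beta>\<^sup>2 + x\<^sup>2)"
  have s: "s > 0" "s\<^sup>2 = \<beta>\<^sup>2 + x\<^sup>2" using x by (auto simp: s_def add_nonneg_pos)
  define f where "f = amos \<alpha> \<beta> x"
  define f' where "f' = (\<alpha> + \<beta>\<^sup>2 / s) / (\<alpha> + s)\<^sup>2"
  have f': "DERIV (amos \<alpha> \<beta>) x :> f'" unfolding f'_def s_def using assms by (rule amos_DERIV)
  define G where "G = (\<lambda>x. x powr (1 - \<nu>) * bessel_K \<nu> x)"
  define B where "B = (\<lambda>x. x powr (1 - \<nu>) * bessel_K (\<nu> - 1) x)"
  have G: "DERIV G x :> - B x - (2 * \<nu> - 1) / x * G x"
  proof -
    have "x powr (1 - \<nu> - 1) = x powr (1 - \<nu>) / x" using x by (simp add: powr_diff powr_minus divide_simps)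
    then have "(1 - \<nu>) * x powr (1 - \<nu> - 1) * bessel_K \<nu> x +
        (- bessel_K (\<nu> - 1) x - \<nu> / x * bessel_K \<nu> x) * x powr (1 - \<nu>)
        = - B x - (2 * \<nu> - 1) / x * G x" using x
      by (simp add: G_def B_def diff_divide_distrib algebra_simps)
    with DERIV_mult[OF has_real_derivative_powr[OF x, of "1 - \<nu>"] bessel_K_DERIV[OF x, of \<nu>]]
    show ?thesis unfolding G_def by simp
  qed
  have B: "DERIV B x :> - G x" unfolding G_def B_def using bessel_K_powr_DERIV'[OF x] .
  have eq: "amos_gap \<nu> \<alpha> \<beta> = (\<lambda>x. (B x - amos \<alpha> \<beta> x * G x) * exp (- amos_primitive \<alpha> \<beta> x))"
    by (simp add: fun_eq_iff amos_gap_def B_def G_def algebra_simps)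
  have "DERIV (amos_gap \<nu> \<alpha> \<beta>) x :>
     (- G x - (f' * G x + f * (- B x - (2 * \<nu> - 1) / x * G x))) * exp (- amos_primitive \<alpha> \<beta> x)
     + (B x - f * G x) * (exp (- amos_primitive \<alpha> \<beta> x) * (- f))"
    unfolding eq f_def
    by (rule DERIV_cong[OF DERIV_mult[OF DERIV_diff[OF B DERIV_mult[OF f' G]]
          DERIV_fun_exp[OF DERIV_minus[OF amos_primitive_DERIV[OF \<alpha> x]]]]]) (simp add: algebra_simps)
  also have "(- G x - (f' * G x + f * (- B x - (2 * \<nu> - 1) / x * G x))) * exp (- amos_primitive \<alpha> \<beta> x)
     + (B x - f * G x) * (exp (- amos_primitive \<alpha> \<beta> x) * (- f))
     = G x * exp (- amos_primitive \<alpha> \<beta> x) * (f\<^sup>2 + (2 * \<nu> - 1) * f / x - 1 - f')"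
    using x by (simp add: field_simps power2_eq_square)
  also have "f\<^sup>2 + (2 * \<nu> - 1) * f / x - 1 - f' = amos_defect \<nu> \<alpha> \<beta> x"
  proof -
    have p: "\<alpha> + s > 0" using s \<alpha> by linarith
    have "f\<^sup>2 + (2 * \<nu> - 1) * f / x - 1 = (x\<^sup>2 + (2 * \<nu> - 1) * (\<alpha> + s) - (\<alpha> + s)\<^sup>2) / (\<alpha> + s)\<^sup>2"
    proof -
      have "(2 * \<nu> - 1) * (x / (\<alpha> + s)) / x = (2 * \<nu> - 1) * (\<alpha> + s) / (\<alpha> + s)\<^sup>2"
        using x p by (simp add: power2_eq_square)
      then show ?thesis
        using p unfolding f_def amos_def s_def[symmetric] power_divide
        by (simp add: add_divide_distrib diff_divide_distrib)
    qed
    also have "x\<^sup>2 = s\<^sup>2 - \<beta>\<^sup>2" using s by simp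
    finally show ?thesis
      unfolding f'_def amos_defect_def s_def[symmetric] Let_def
      by (simp add: diff_divide_distrib[symmetric]) (simp add: algebra_simps power2_eq_square)
  qed
  finally show ?thesis by (simp add: G_def)
qed

text \<open>The bracket is at most twice \<open>bessel_K \<nu> x\<close>, because
  \<open>amos\<close> lies between 0 and 1 and the order \<nu> - 1 gives the smaller Bessel
  function. The exponential decay of \<open>bessel_K\<close> then beats the power, while the
  primitive is nondecreasing and so keeps the last factor bounded.\<close>

lemma amos_gap_tendsto_0:
  assumes \<nu>: "\<nu> > 1/2" and \<alpha>: "\<alpha> \<ge> 0"
  shows "(amos_gap \<nu> \<alpha> \<beta> \<longlongrightarrow> 0) at_top"
proof (rule tendsto_0_le[where K=1])
  let ?P = "amos_primitive \<alpha> \<beta>"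
  let ?C = "2 * bessel_K \<nu> 1 * exp (- ?P 1)"
  show "((\<lambda>x. x powr (1 - \<nu>) * exp (- (x - 1)) * ?C) \<longlongrightarrow> 0) at_top"
    by (rule tendsto_mult_left_zero) real_asymp
  show "\<forall>\<^sub>F x in at_top. norm (amos_gap \<nu> \<alpha> \<beta> x) \<le> norm (x powr (1 - \<nu>) * exp (- (x - 1)) * ?C) * 1"
    using eventually_ge_at_top[of 1]
  proof eventually_elim
    case (elim x)
    then have x: "x > 0" by simp
    have "?P 1 \<le> ?P x"
    proof (rule DERIV_nonneg_imp_nondecreasing[OF elim])
      fix t :: real assume "1 \<le> t"
      then have "t > 0" by simp
      then show "\<exists>y. DERIV ?P t :> y \<and> 0 \<le> y"
        using amos_primitive_DERIV[OF \<alpha>] amos_pos[OF \<alpha>] less_imp_le by blast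
    qed
    then have P: "exp (- ?P x) \<le> exp (- ?P 1)" by simp
    have "\<bar>bessel_K (\<nu> - 1) x - amos \<alpha> \<beta> x * bessel_K \<nu> x\<bar> \<le> bessel_K (\<nu> - 1) x + amos \<alpha> \<beta> x * bessel_K \<nu> x"
      using bessel_K_pos[OF x, of "\<nu> - 1"] bessel_K_pos[OF x, of \<nu>] amos_pos[OF \<alpha> x, of \<beta>]
      by (smt (verit) mult_pos_pos)
    also have "\<dots> \<le> bessel_K \<nu> x + 1 * bessel_K \<nu> x"
      using bessel_K_lt_shift[OF \<nu> x] bessel_K_pos[OF x, of \<nu>] amos_le_1[OF \<alpha> x]
      by (intro add_mono mult_right_mono) auto
    also have "\<dots> \<le> 2 * (exp (- (x - 1)) * bessel_K \<nu> 1)" using bessel_K_decay[of 1 x \<nu>] elim by simp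
    finally have "\<bar>amos_gap \<nu> \<alpha> \<beta> x\<bar> \<le> x powr (1 - \<nu>) * (2 * (exp (- (x - 1)) * bessel_K \<nu> 1)) * exp (- ?P 1)"
      unfolding amos_gap_def abs_mult using P by (intro mult_mono) (auto intro!: mult_nonneg_nonneg less_imp_le bessel_K_pos)
    also have "\<dots> \<le> \<bar>x powr (1 - \<nu>) * exp (- (x - 1)) * ?C\<bar>" by (rule order_trans[OF _ abs_ge_self]) (simp add: algebra_simps)
    finally show ?case by simp
  qed
qed

lemma DERIV_pos_tendsto_0_imp_neg:
  fixes E :: "real \<Rightarrow> real"
  assumes D: "\<And>x. x > 0 \<Longrightarrow> DERIV E x :> E' x" and pos: "\<And>x. x > 0 \<Longrightarrow> E' x > 0"
    and lim: "(E \<longlongrightarrow> 0) at_top" and x: "x > 0"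
  shows "E x < 0"
proof -
  have mono: "E u < E v" if "0 < u" "u < v" for u v
    
  proof (rule DERIV_pos_imp_increasing[OF that(2)])
    fix t assume "u \<le> t"
    then have "t > 0" using that by simp
    then show "\<exists>y. DERIV E t :> y \<and> 0 < y" using D pos by blast
  qed
  \<comment> \<open>Passing to the limit yields only a weak inequality; the detour through
    \<open>x + 1\<close> restores strictness.\<close>
  have "E (x + 1) \<le> 0"
  proof (rule tendsto_lowerbound[OF lim])
    show "\<forall>\<^sub>F y in at_top. E (x + 1) \<le> E y"
      using eventually_gt_at_top[of "x + 1"] by eventually_elim (use x in \<open>auto intro!: less_imp_le mono\<close>)
  qed auto
  with mono[of x "x + 1"] x show ?thesis by simp
qed

context
  fixes \<nu> \<alpha> \<beta> :: real
  assumes \<nu>: "\<nu> > 1/2" and \<alpha>: "\<alpha> \<ge> 0"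
begin

lemma bessel_ratio_less_amos:
  assumes "\<And>x. x > 0 \<Longrightarrow> amos_defect \<nu> \<alpha> \<beta> x > 0" and x: "x > 0"
  shows "bessel_K (\<nu> - 1) x / bessel_K \<nu> x < amos \<alpha> \<beta> x"
proof -
  have "amos_gap \<nu> \<alpha> \<beta> x < 0"
    by (rule DERIV_pos_tendsto_0_imp_neg[OF amos_gap_DERIV _ amos_gap_tendsto_0])
      (use \<alpha> \<nu> x assms(1) bessel_K_pos in \<open>auto intro!: mult_pos_pos\<close>)
  then show ?thesis using bessel_K_pos[OF x] x
    by (simp add: amos_gap_def mult_less_0_iff divide_less_eq)
qed

lemma bessel_ratio_greater_amos:
  assumes "\<And>x. x > 0 \<Longrightarrow> amos_defect \<nu> \<alpha> \<beta> x < 0" and x: "x > 0"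
  shows "bessel_K (\<nu> - 1) x / bessel_K \<nu> x > amos \<alpha> \<beta> x"
proof -
  have "- amos_gap \<nu> \<alpha> \<beta> x < 0"
    by (rule DERIV_pos_tendsto_0_imp_neg[OF DERIV_minus[OF amos_gap_DERIV] _ tendsto_minus[OF amos_gap_tendsto_0, simplified]])
      (use \<alpha> \<nu> x assms(1) bessel_K_pos in \<open>auto intro!: mult_pos_neg\<close>)
  then show ?thesis using bessel_K_pos[OF x] x
    by (simp add: amos_gap_def zero_less_mult_iff less_divide_eq)
qed

text \<open>A vanishing defect makes \<open>amos_gap\<close> constant, and its limit at infinity
  forces the constant to be 0.\<close>

lemma bessel_ratio_eq_amos:
  assumes "\<And>x. x > 0 \<Longrightarrow> amos_defect \<nu> \<alpha> \<beta> x = 0" and x: "x > 0"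
  shows "bessel_K (\<nu> - 1) x / bessel_K \<nu> x = amos \<alpha> \<beta> x"
proof -
  have D: "DERIV (amos_gap \<nu> \<alpha> \<beta>) y :> 0" if "y > 0" for y
    using amos_gap_DERIV[OF \<alpha> that, of \<nu> \<beta>] assms(1)[OF that] by simp
  have const: "amos_gap \<nu> \<alpha> \<beta> y = amos_gap \<nu> \<alpha> \<beta> x" if "y > x" for y
  proof (rule DERIV_isconst_end[OF that])
    show "continuous_on {x..y} (amos_gap \<nu> \<alpha> \<beta>)"
      by (rule DERIV_continuous_on[where D = "\<lambda>_. 0"])
        (use D x in \<open>auto intro: has_field_derivative_at_within\<close>)
  qed (use D x in auto)
  have "\<forall>\<^sub>F y in at_top. amos_gap \<nu> \<alpha> \<beta> y = amos_gap \<nu> \<alpha> \<beta> x"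
    using eventually_gt_at_top[of x] by eventually_elim (rule const)
  then have "(amos_gap \<nu> \<alpha> \<beta> \<longlongrightarrow> amos_gap \<nu> \<alpha> \<beta> x) at_top" by (rule tendsto_eventually)
  with amos_gap_tendsto_0[OF \<nu> \<alpha>] have "amos_gap \<nu> \<alpha> \<beta> x = 0"
    using tendsto_unique[of at_top] by (metis trivial_limit_at_top_linorder)
  then show ?thesis using bessel_K_pos[OF x, of \<nu>] x
    by (simp add: amos_gap_def field_simps)
qed

end

section \<open>The three bounds for the ratio\<close>

definition bessel_ratio :: "real \<Rightarrow> real \<Rightarrow> real" where
  "bessel_ratio \<nu> x = bessel_K (\<nu> - 1) x / bessel_K \<nu> x"

lemma abs_less_sqrt: "x > 0 \<Longrightarrow> \<bar>\<beta>\<bar> < sqrt (\<beta>\<^sup>2 + x\<^sup>2)" for x :: real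
  by (rule real_less_rsqrt) simp

text \<open>For \<alpha> = \<beta> = \<nu> - 1/2 the function f =
  \<open>amos \<alpha> \<alpha>\<close> annihilates the right-hand side f^2 + (2\<nu> - 1) f / x - 1
  of the Riccati equation. Its defect is therefore - f', and f increases.\<close>

lemma bessel_ratio_lower:
  assumes "\<nu> > 1/2" "x > 0"
  shows "bessel_ratio \<nu> x > amos (\<nu> - 1/2) (\<nu> - 1/2) x"
  unfolding bessel_ratio_def
proof (rule bessel_ratio_greater_amos)
  fix x :: real assume x: "x > 0"
  define \<alpha> where "\<alpha> = \<nu> - 1/2"
  define s where "s = sqrt (\<alpha>\<^sup>2 + x\<^sup>2)"
  have "\<alpha> > 0" using assms by (simp add: \<alpha>_def)
  then have "s > 0" using abs_less_sqrt[OF x, of \<alpha>] unfolding s_def by linarith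
  have "(2 * \<nu> - 1 - 2 * \<alpha>) * s + (2 * \<nu> - 1) * \<alpha> - \<alpha>\<^sup>2 - \<alpha>\<^sup>2 - \<alpha> - \<alpha>\<^sup>2 / s = - (\<alpha> + \<alpha>\<^sup>2 / s)"
    by (simp add: \<alpha>_def power2_eq_square algebra_simps)
  also have "\<dots> < 0" 
  proof -
    have "\<alpha>\<^sup>2 / s > 0" using \<open>\<alpha> > 0\<close> \<open>s > 0\<close> by simp
    with \<open>\<alpha> > 0\<close> show ?thesis by linarith
  qed
  finally show "amos_defect \<nu> (\<nu> - 1/2) (\<nu> - 1/2) x < 0"
    unfolding amos_defect_def \<alpha>_def[symmetric] s_def[symmetric] Let_def
    using \<open>\<alpha> > 0\<close> \<open>s > 0\<close> by (intro divide_neg_pos zero_less_power) auto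
qed (use assms in auto)

text \<open>For \<alpha> = \<beta> = \<nu> - 1 the function f satisfies f^2 + 2 (\<nu> - 1) f / x =
  1, so the defect is f / x - f'. This is positive because f / x = 1 / (\<alpha> + s) decreases,
  where s = \<open>sqrt (\<alpha>\<^sup>2 + x\<^sup>2)\<close>.\<close>

lemma bessel_ratio_upper:
  assumes "\<nu> > 1" "x > 0"
  shows "bessel_ratio \<nu> x < amos (\<nu> - 1) (\<nu> - 1) x"
  unfolding bessel_ratio_def
proof (rule bessel_ratio_less_amos)
  fix x :: real assume x: "x > 0"
  define \<alpha> where "\<alpha> = \<nu> - 1"
  define s where "s = sqrt (\<alpha>\<^sup>2 + x\<^sup>2)"
  have \<alpha>: "\<alpha> > 0" "\<alpha> < s" using assms abs_less_sqrt[OF x, of \<alpha>] by (auto simp: \<alpha>_def s_def)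
  have "\<alpha>\<^sup>2 / s < s" using \<alpha> by (simp add: divide_less_eq power2_eq_square mult_strict_mono)
  moreover have "(2 * \<nu> - 1 - 2 * \<alpha>) * s + (2 * \<nu> - 1) * \<alpha> - \<alpha>\<^sup>2 - \<alpha>\<^sup>2 - \<alpha> - \<alpha>\<^sup>2 / s = s - \<alpha>\<^sup>2 / s"
    by (simp add: \<alpha>_def power2_eq_square algebra_simps)
  ultimately show "amos_defect \<nu> (\<nu> - 1) (\<nu> - 1) x > 0"
    unfolding amos_defect_def \<alpha>_def[symmetric] s_def[symmetric] Let_def
    using \<alpha> by (intro divide_pos_pos zero_less_power) auto
qed (use assms in auto)

text \<open>With \<alpha> = \<nu> - 1/2 the coefficient of s in the numerator vanishes, and \<beta>
  = \<nu> - 3/2 lets the rest factor. The defect has the sign of \<beta>, negative values included;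
  hence the threshold \<nu> = 3/2, that is r = 4, in (C).\<close>

lemma amos_defect_sharp:
  fixes \<beta> x :: real
  assumes x: "x > 0"
  defines "s \<equiv> sqrt (\<beta>\<^sup>2 + x\<^sup>2)"
  shows "amos_defect (\<beta> + 3/2) (\<beta> + 1) \<beta> x = \<beta> * ((1 - \<beta> / s) / (\<beta> + 1 + s)\<^sup>2)"
    and "(1 - \<beta> / s) / (\<beta> + 1 + s)\<^sup>2 > 0"
proof -
  have s: "\<beta> < s" "s > 0" "\<beta> + 1 + s > 0"
    using abs_less_sqrt[OF x, of \<beta>] unfolding s_def by linarith+
  then show "(1 - \<beta> / s) / (\<beta> + 1 + s)\<^sup>2 > 0" by simp
  have "(2 * (\<beta> + 3/2) - 1 - 2 * (\<beta> + 1)) * s + (2 * (\<beta> + 3/2) - 1) * (\<beta> + 1)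
      - (\<beta> + 1)\<^sup>2 - \<beta>\<^sup>2 - (\<beta> + 1) - \<beta>\<^sup>2 / s = \<beta> * (1 - \<beta> / s)"
    by (simp add: power2_eq_square algebra_simps)
  then show "amos_defect (\<beta> + 3/2) (\<beta> + 1) \<beta> x = \<beta> * ((1 - \<beta> / s) / (\<beta> + 1 + s)\<^sup>2)"
    unfolding amos_defect_def Let_def s_def[symmetric] by (simp only: times_divide_eq_right)
qed

lemma bessel_ratio_sharp:
  assumes \<nu>: "\<nu> > 1/2" and x: "x > 0"
  shows "\<nu> > 3/2 \<Longrightarrow> bessel_ratio \<nu> x < amos (\<nu> - 1/2) (\<nu> - 3/2) x"
    and "\<nu> = 3/2 \<Longrightarrow> bessel_ratio \<nu> x = amos (\<nu> - 1/2) (\<nu> - 3/2) x"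
    and "\<nu> < 3/2 \<Longrightarrow> bessel_ratio \<nu> x > amos (\<nu> - 1/2) (\<nu> - 3/2) x"
proof -
  define \<beta> where "\<beta> = \<nu> - 3/2"
  have eq: "\<nu> - 3/2 = \<beta>" "\<nu> - 1/2 = \<beta> + 1" "amos_defect \<nu> = amos_defect (\<beta> + 3/2)" by (auto simp: \<beta>_def)
  have a: "\<beta> + 1 \<ge> 0" using \<nu> by (simp add: \<beta>_def)
  show "bessel_ratio \<nu> x < amos (\<nu> - 1/2) (\<nu> - 3/2) x" if "\<nu> > 3/2"
    unfolding bessel_ratio_def eq
  proof (rule bessel_ratio_less_amos[OF \<nu> a _ x])
    fix y :: real assume "y > 0"
    then show "amos_defect \<nu> (\<beta> + 1) \<beta> y > 0"
      unfolding eq amos_defect_sharp(1)[OF \<open>y > 0\<close>] using that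
      by (intro mult_pos_pos amos_defect_sharp(2)) (auto simp: \<beta>_def)
  qed
  show "bessel_ratio \<nu> x = amos (\<nu> - 1/2) (\<nu> - 3/2) x" if "\<nu> = 3/2"
    unfolding bessel_ratio_def eq
  proof (rule bessel_ratio_eq_amos[OF \<nu> a _ x])
    fix y :: real assume "y > 0"
    then show "amos_defect \<nu> (\<beta> + 1) \<beta> y = 0"
      unfolding eq amos_defect_sharp(1)[OF \<open>y > 0\<close>] using that by (simp add: \<beta>_def)
  qed
  show "bessel_ratio \<nu> x > amos (\<nu> - 1/2) (\<nu> - 3/2) x" if "\<nu> < 3/2"
    unfolding bessel_ratio_def eq
  proof (rule bessel_ratio_greater_amos[OF \<nu> a _ x])
    fix y :: real assume "y > 0"
    then show "amos_defect \<nu> (\<beta> + 1) \<beta> y < 0"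
      unfolding eq amos_defect_sharp(1)[OF \<open>y > 0\<close>] using that
      by (intro mult_neg_pos amos_defect_sharp(2)) (auto simp: \<beta>_def)
  qed
qed

lemma bessel_ratio_pos: "x > 0 \<Longrightarrow> bessel_ratio \<nu> x > 0"
  by (simp add: bessel_ratio_def bessel_K_pos)

section \<open>The Riccati equation, monotonicity of the ratio, and its roots\<close>

lemma bessel_ratio_DERIV:
  assumes x: "x > 0"
  shows "DERIV (bessel_ratio \<nu>) x :> (bessel_ratio \<nu> x)\<^sup>2 + (2 * \<nu> - 1) / x * bessel_ratio \<nu> x - 1"
proof -
  let ?p = "bessel_K (\<nu> - 1) x" and ?q = "bessel_K \<nu> x"
  have q: "?q \<noteq> 0" using bessel_K_pos[OF x] by (simp add: less_imp_neq[THEN not_sym])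
  \<comment> \<open>Order 1 - \<nu> in place of \<nu> - 1 makes the derivative involve order \<nu>
    rather than \<nu> - 2, which closes the system.\<close>
  have "DERIV (bessel_K (\<nu> - 1)) x :> - (bessel_K \<nu> x) + (\<nu> - 1) / x * ?p"
  proof -
    have "bessel_K (1 - \<nu>) = bessel_K (\<nu> - 1)" using bessel_K_minus[of "\<nu> - 1"] by auto
    then show ?thesis
      using bessel_K_DERIV[OF x, of "1 - \<nu>"] bessel_K_minus[of \<nu>]
      by (simp add: diff_divide_distrib algebra_simps)
  qed
  from DERIV_divide[OF this bessel_K_DERIV[OF x, of \<nu>] q]
  have "DERIV (bessel_ratio \<nu>) x :>
     ((- ?q + (\<nu> - 1) / x * ?p) * ?q - ?p * (- ?p - \<nu> / x * ?q)) / (?q * ?q)"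
    by (simp add: bessel_ratio_def[abs_def])
  also have "((- ?q + (\<nu> - 1) / x * ?p) * ?q - ?p * (- ?p - \<nu> / x * ?q)) / (?q * ?q) = (bessel_ratio \<nu> x)\<^sup>2 + (2 * \<nu> - 1) / x * bessel_ratio \<nu> x - 1"
    using q x by (simp add: bessel_ratio_def field_simps power2_eq_square)
  finally show ?thesis .
qed

text \<open>With s = \<open>sqrt (\<beta>\<^sup>2 + x\<^sup>2)\<close> the equation
  \<open>amos \<alpha> \<beta> x = \<kappa>\<close> reads x = \<kappa> (\<alpha> + s), which gives a
  quadratic s^2 = \<beta>^2 + \<kappa>^2 (\<alpha> + s)^2. A quarter of its discriminant is q^2, and
  its nonnegative root is s = (\<kappa>^2 \<alpha> + q) / (1 - \<kappa>^2).\<close>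

lemma amos_at_root:
  fixes \<kappa> \<alpha> \<beta> :: real
  assumes \<kappa>: "0 < \<kappa>" "\<kappa> < 1" and \<alpha>: "\<alpha> \<ge> 0"
  defines "q \<equiv> sqrt (\<kappa>\<^sup>2 * \<alpha>\<^sup>2 + (1 - \<kappa>\<^sup>2) * \<beta>\<^sup>2)"
  assumes pos: "\<alpha> + q > 0"
  shows "amos \<alpha> \<beta> (\<kappa> * (\<alpha> + q) / (1 - \<kappa>\<^sup>2)) = \<kappa>"
proof -
  have k: "1 - \<kappa>\<^sup>2 > 0" using \<kappa> by (simp add: power_less_one_iff abs_square_less_1)
  have q: "q \<ge> 0" "q\<^sup>2 = \<kappa>\<^sup>2 * \<alpha>\<^sup>2 + (1 - \<kappa>\<^sup>2) * \<beta>\<^sup>2"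
    unfolding q_def using k by (auto intro!: real_sqrt_ge_zero add_nonneg_nonneg mult_nonneg_nonneg)
  let ?y = "\<kappa> * (\<alpha> + q) / (1 - \<kappa>\<^sup>2)"
  have "sqrt (\<beta>\<^sup>2 + ?y\<^sup>2) = (\<kappa>\<^sup>2 * \<alpha> + q) / (1 - \<kappa>\<^sup>2)"
  proof (rule real_sqrt_unique)
    have "(\<kappa>\<^sup>2 * \<alpha> + q)\<^sup>2 - \<kappa>\<^sup>2 * (\<alpha> + q)\<^sup>2 = (1 - \<kappa>\<^sup>2) * (q\<^sup>2 - \<kappa>\<^sup>2 * \<alpha>\<^sup>2)"
      by (simp add: power2_eq_square algebra_simps)
    also have "\<dots> = \<beta>\<^sup>2 * (1 - \<kappa>\<^sup>2)\<^sup>2" unfolding q(2) by (simp add: power2_eq_square algebra_simps)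
    finally have e: "(\<kappa>\<^sup>2 * \<alpha> + q)\<^sup>2 = \<beta>\<^sup>2 * (1 - \<kappa>\<^sup>2)\<^sup>2 + (\<kappa> * (\<alpha> + q))\<^sup>2"
      by (simp add: power_mult_distrib)
    show "((\<kappa>\<^sup>2 * \<alpha> + q) / (1 - \<kappa>\<^sup>2))\<^sup>2 = \<beta>\<^sup>2 + ?y\<^sup>2"
      unfolding power_divide e using k by (simp add: add_divide_distrib)
    show "(\<kappa>\<^sup>2 * \<alpha> + q) / (1 - \<kappa>\<^sup>2) \<ge> 0" using k q \<alpha> by simp
  qed
  then have "\<alpha> + sqrt (\<beta>\<^sup>2 + ?y\<^sup>2) = (\<alpha> + q) / (1 - \<kappa>\<^sup>2)"
    using k by (simp add: field_simps)
  then show ?thesis unfolding amos_def using k pos by simp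
qed

lemma amos_diag_at_root:
  assumes "0 < \<kappa>" "\<kappa> < 1" "\<alpha> > 0"
  shows "amos \<alpha> \<alpha> (2 * \<alpha> * \<kappa> / (1 - \<kappa>\<^sup>2)) = \<kappa>"
proof -
  have "\<kappa>\<^sup>2 * \<alpha>\<^sup>2 + (1 - \<kappa>\<^sup>2) * \<alpha>\<^sup>2 = \<alpha>\<^sup>2" by (simp add: algebra_simps)
  then show ?thesis using amos_at_root[of \<kappa> \<alpha> \<alpha>] assms by (simp add: algebra_simps)
qed

lemma amos_diag_quadratic:
  assumes "\<alpha> > 0" "x > 0"
  shows "(amos \<alpha> \<alpha> x)\<^sup>2 + 2 * \<alpha> / x * amos \<alpha> \<alpha> x = 1"
proof -
  define s where "s = sqrt (\<alpha>\<^sup>2 + x\<^sup>2)"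
  have s: "s > 0" "s\<^sup>2 = \<alpha>\<^sup>2 + x\<^sup>2" using assms by (auto simp: s_def add_pos_pos)
  have p: "\<alpha> + s > 0" using s assms by linarith
  have "(amos \<alpha> \<alpha> x)\<^sup>2 + 2 * \<alpha> / x * amos \<alpha> \<alpha> x = (x\<^sup>2 + 2 * \<alpha> * (\<alpha> + s)) / (\<alpha> + s)\<^sup>2"
  proof -
    have "2 * \<alpha> / x * (x / (\<alpha> + s)) = 2 * \<alpha> * (\<alpha> + s) / (\<alpha> + s)\<^sup>2"
      using p assms by (simp add: power2_eq_square)
    then show ?thesis unfolding amos_def s_def[symmetric] power_divide by (simp add: add_divide_distrib)
  qed
  also have "x\<^sup>2 = s\<^sup>2 - \<alpha>\<^sup>2" using s by simp
  also have "s\<^sup>2 - \<alpha>\<^sup>2 + 2 * \<alpha> * (\<alpha> + s) = (\<alpha> + s)\<^sup>2" by (simp add: power2_eq_square algebra_simps)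
  finally show ?thesis using p by simp
qed

text \<open>The right-hand side of the Riccati equation increases in the positive value R and
  vanishes at \<open>amos (\<nu> - 1/2) (\<nu> - 1/2)\<close>, by
  \<open>amos_diag_quadratic\<close>. The ratio lies strictly above that zero, so its derivative is
  positive.\<close>

lemma bessel_ratio_strict_mono:
  assumes \<nu>: "\<nu> > 1/2" and x: "0 < x" "x < y"
  shows "bessel_ratio \<nu> x < bessel_ratio \<nu> y"
proof (rule DERIV_pos_imp_increasing[OF x(2)])
  fix t assume t: "x \<le> t" "t \<le> y"
  then have t0: "t > 0" using x by simp
  let ?R = "bessel_ratio \<nu> t" and ?f = "amos (\<nu> - 1/2) (\<nu> - 1/2) t"
  have f: "?f > 0" "?f < ?R" using amos_pos[of "\<nu> - 1/2" t] \<nu> t0 bessel_ratio_lower[OF \<nu> t0] by auto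
  have "1 = ?f\<^sup>2 + (2 * \<nu> - 1) / t * ?f" using amos_diag_quadratic[of "\<nu> - 1/2" t] \<nu> t0 by (simp add: algebra_simps)
  also have "\<dots> < ?R\<^sup>2 + (2 * \<nu> - 1) / t * ?R"
    using f \<nu> t0 by (intro add_strict_mono power_strict_mono mult_strict_left_mono) auto
  finally have "?R\<^sup>2 + (2 * \<nu> - 1) / t * ?R - 1 > 0" by simp
  with bessel_ratio_DERIV[OF t0, of \<nu>] show "\<exists>D. DERIV (bessel_ratio \<nu>) t :> D \<and> 0 < D" by blast
qed

lemma bessel_ratio_less_iff:
  assumes "\<nu> > 1/2" "0 < x" "0 < y"
  shows "bessel_ratio \<nu> x < bessel_ratio \<nu> y \<longleftrightarrow> x < y"
  using bessel_ratio_strict_mono[OF assms(1), of x y] bessel_ratio_strict_mono[OF assms(1), of y x] assms(2,3)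
  by (cases x y rule: linorder_cases) auto

text \<open>Intermediate values: the lower Amos bound equals \<kappa> at \<open>y1\<close>, so the
  ratio exceeds \<kappa> there, and somewhere near 0 the ratio must fall below \<kappa>.\<close>

lemma bessel_ratio_root_exists:
  assumes \<nu>: "\<nu> > 1/2" and \<kappa>: "0 < \<kappa>" "\<kappa> < 1"
  shows "\<exists>y>0. bessel_ratio \<nu> y = \<kappa>"
proof -
  define a where "a = \<nu> - 1/2"
  have a: "a > 0" "2 * a = 2 * \<nu> - 1" using \<nu> by (auto simp: a_def)
  have k: "1 - \<kappa>\<^sup>2 > 0" using \<kappa> by (simp add: power_less_one_iff abs_square_less_1)
  define y1 where "y1 = 2 * a * \<kappa> / (1 - \<kappa>\<^sup>2)"
  have y1: "y1 > 0" using a k \<kappa> by (simp add: y1_def)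
  have up: "bessel_ratio \<nu> y1 > \<kappa>"
    using bessel_ratio_lower[OF \<nu> y1] amos_diag_at_root[OF \<kappa> a(1)] by (simp add: a_def y1_def)
  txt \<open>If the ratio stayed above \<open>\<kappa>\<close>, its derivative would be at least of order \<open>1/x\<close> near \<open>0\<close>.\<close>
  have "\<exists>y>0. bessel_ratio \<nu> y < \<kappa>"
  proof (rule ccontr)
    assume "\<not> ?thesis"
    then have ge: "bessel_ratio \<nu> y \<ge> \<kappa>" if "y > 0" for y using that by force
    \<comment> \<open>The summand \<open>x\<close> cancels the - 1 of the Riccati equation and the
      logarithm integrates the term of order 1/x. Monotonicity then bounds \<open>- ln x\<close> on
      (0, 1] by a constant; \<open>x0\<close> is chosen to overshoot that bound by 1.\<close>
    let ?g = "\<lambda>x. bessel_ratio \<nu> x + x - 2 * a * \<kappa> * ln x"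
    have "?g x \<le> ?g 1" if x: "0 < x" "x \<le> 1" for x
    proof (rule DERIV_nonneg_imp_nondecreasing[OF x(2)])
      fix t assume "x \<le> t" "t \<le> 1"
      then have t: "t > 0" using x by simp
      have "DERIV ?g t :> ((bessel_ratio \<nu> t)\<^sup>2 + (2 * \<nu> - 1) / t * bessel_ratio \<nu> t - 1) + 1 - 2 * a * \<kappa> * (1 / t)"
        using t by (auto intro!: derivative_eq_intros bessel_ratio_DERIV)
      moreover
      have "(2 * \<nu> - 1) / t * bessel_ratio \<nu> t \<ge> 2 * a / t * \<kappa>"
        using ge[OF t] a t \<kappa> by (intro mult_mono) auto
      then have "0 \<le> ((bessel_ratio \<nu> t)\<^sup>2 + (2 * \<nu> - 1) / t * bessel_ratio \<nu> t - 1) + 1 - 2 * a * \<kappa> * (1 / t)"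
        by (simp add: add_increasing)
      ultimately show "\<exists>D. DERIV ?g t :> D \<and> 0 \<le> D" by blast
    qed
    then have bound: "- 2 * a * \<kappa> * ln x \<le> bessel_ratio \<nu> 1 + 1" if "0 < x" "x \<le> 1" for x
      using bessel_ratio_pos[of x \<nu>] that by force
    define C where "C = bessel_ratio \<nu> 1 + 1"
    have C: "C > 0" using bessel_ratio_pos[of 1 \<nu>] by (simp add: C_def)
    define x0 where "x0 = exp (- (C + 1) / (2 * a * \<kappa>))"
    have "- 2 * a * \<kappa> * ln x0 = C + 1" using a(1) \<kappa> by (simp add: x0_def)
    moreover have "0 < x0" "x0 \<le> 1" using a(1) \<kappa> C by (auto simp: x0_def divide_le_0_iff)
    ultimately show False using bound[of x0] by (simp add: C_def)
  qed
  then obtain y0 where y0: "y0 > 0" "bessel_ratio \<nu> y0 < \<kappa>" by blast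
  then have "y0 < y1" using up bessel_ratio_less_iff[OF \<nu> y0(1) y1] by simp
  have "\<exists>y\<ge>y0. y \<le> y1 \<and> bessel_ratio \<nu> y = \<kappa>"
  proof (rule IVT)
    show "\<forall>x. y0 \<le> x \<and> x \<le> y1 \<longrightarrow> isCont (bessel_ratio \<nu>) x"
      using y0 DERIV_isCont[OF bessel_ratio_DERIV] by auto
  qed (use y0 up \<open>y0 < y1\<close> in auto)
  then show ?thesis using y0(1) less_le_trans by blast
qed

text \<open>Where an Amos function takes the value \<kappa>, the ratio is larger or smaller than
  \<kappa> according to the bound in force. As the ratio increases, lower bounds for it become upper
  bounds for its root, and conversely.\<close>

lemma bessel_ratio_root_bounds:
  fixes \<nu> \<kappa> y :: real
  assumes \<nu>: "\<nu> > 1/2" and \<kappa>: "0 < \<kappa>" "\<kappa> < 1" and y: "y > 0" "bessel_ratio \<nu> y = \<kappa>"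
  defines "z \<equiv> \<kappa> * (\<nu> - 1/2 + sqrt (\<kappa>\<^sup>2 * (\<nu> - 1/2)\<^sup>2 + (1 - \<kappa>\<^sup>2) * (\<nu> - 3/2)\<^sup>2)) / (1 - \<kappa>\<^sup>2)"
  shows "y < 2 * (\<nu> - 1/2) * \<kappa> / (1 - \<kappa>\<^sup>2)"
    and "\<nu> > 1 \<Longrightarrow> y > 2 * (\<nu> - 1) * \<kappa> / (1 - \<kappa>\<^sup>2)"
    and "\<nu> > 3/2 \<Longrightarrow> y > z"
    and "\<nu> = 3/2 \<Longrightarrow> y = z"
    and "\<nu> < 3/2 \<Longrightarrow> y < z"
proof -
  have k: "1 - \<kappa>\<^sup>2 > 0" using \<kappa> by (simp add: power_less_one_iff abs_square_less_1)
  let ?y1 = "2 * (\<nu> - 1/2) * \<kappa> / (1 - \<kappa>\<^sup>2)"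
  have y1: "?y1 > 0" using \<nu> k \<kappa> by (intro divide_pos_pos mult_pos_pos) auto
  have "bessel_ratio \<nu> y < bessel_ratio \<nu> ?y1"
    using bessel_ratio_lower[OF \<nu> y1] amos_diag_at_root[OF \<kappa>, of "\<nu> - 1/2"] \<nu> y by simp
  then show "y < ?y1" using bessel_ratio_less_iff[OF \<nu> y(1) y1] by simp
  show "y > 2 * (\<nu> - 1) * \<kappa> / (1 - \<kappa>\<^sup>2)" if "\<nu> > 1"
  proof -
    let ?y2 = "2 * (\<nu> - 1) * \<kappa> / (1 - \<kappa>\<^sup>2)"
    have y2: "?y2 > 0" using that k \<kappa> by (intro divide_pos_pos mult_pos_pos) auto
    have "bessel_ratio \<nu> ?y2 < bessel_ratio \<nu> y"
      using bessel_ratio_upper[OF that y2] amos_diag_at_root[OF \<kappa>, of "\<nu> - 1"] that y by simp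
    then show ?thesis using bessel_ratio_less_iff[OF \<nu> y2 y(1)] by simp
  qed
  have q: "sqrt (\<kappa>\<^sup>2 * (\<nu> - 1/2)\<^sup>2 + (1 - \<kappa>\<^sup>2) * (\<nu> - 3/2)\<^sup>2) \<ge> 0"
    using k by (intro real_sqrt_ge_zero add_nonneg_nonneg mult_nonneg_nonneg) auto
  then have pos: "\<nu> - 1/2 + sqrt (\<kappa>\<^sup>2 * (\<nu> - 1/2)\<^sup>2 + (1 - \<kappa>\<^sup>2) * (\<nu> - 3/2)\<^sup>2) > 0"
    using \<nu> by linarith
  have z: "z > 0" unfolding z_def using k \<kappa> by (intro divide_pos_pos mult_pos_pos pos) auto
  have az: "amos (\<nu> - 1/2) (\<nu> - 3/2) z = \<kappa>"
    unfolding z_def using \<nu> \<kappa> pos by (intro amos_at_root) auto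
  show "y > z" if "\<nu> > 3/2"
    using bessel_ratio_sharp(1)[OF \<nu> z that] az y bessel_ratio_less_iff[OF \<nu> z y(1)] by simp
  show "y < z" if "\<nu> < 3/2"
    using bessel_ratio_sharp(3)[OF \<nu> z that] az y bessel_ratio_less_iff[OF \<nu> y(1) z] by simp
  show "y = z" if "\<nu> = 3/2"
    using bessel_ratio_sharp(2)[OF \<nu> z that] az y bessel_ratio_less_iff[OF \<nu> y(1) z] bessel_ratio_less_iff[OF \<nu> z y(1)]
    by simp
qed

section \<open>One-sided variance-gamma densities\<close>

definition bessel_kernel :: "real \<Rightarrow> real \<Rightarrow> real" where
  "bessel_kernel \<nu> x = x powr \<nu> * bessel_K \<nu> x"

lemma bessel_kernel_pos: "x > 0 \<Longrightarrow> bessel_kernel \<nu> x > 0"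
  by (simp add: bessel_kernel_def bessel_K_pos)

lemma bessel_kernel_DERIV:
  assumes x: "x > 0"
  shows "DERIV (bessel_kernel \<nu>) x :> - bessel_kernel \<nu> x * bessel_ratio \<nu> x"
  using bessel_K_powr_DERIV[OF x, of \<nu>] bessel_K_pos[OF x, of \<nu>]
  by (simp add: bessel_kernel_def[abs_def] bessel_ratio_def)

lemma bessel_kernel_strict_antimono:
  assumes "0 < x" "x < y"
  shows "bessel_kernel \<nu> y < bessel_kernel \<nu> x"
proof (rule DERIV_neg_imp_decreasing[OF assms(2)])
  fix t assume "x \<le> t"
  then have t: "t > 0" using assms by simp
  show "\<exists>D. DERIV (bessel_kernel \<nu>) t :> D \<and> D < 0"
    using bessel_kernel_DERIV[OF t] bessel_kernel_pos[OF t] bessel_ratio_pos[OF t]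
    by (intro exI conjI) auto
qed

text \<open>The modulus of \<nu> - 1 is at most that of \<nu> exactly for \<nu> \<ge> 1/2. At \<nu>
  = 1/2 the two orders are opposite and the ratio is 1, which the strict monotonicity in the order
  does not cover.\<close>

lemma bessel_ratio_le_1:
  assumes "\<nu> \<ge> 1/2" "x > 0"
  shows "bessel_ratio \<nu> x \<le> 1"
proof (cases "\<nu> = 1/2")
  case True
  then have "\<nu> - 1 = - \<nu>" by simp
  then have "bessel_K (\<nu> - 1) x = bessel_K \<nu> x" by (simp only: bessel_K_minus)
  then show ?thesis using bessel_K_pos[OF assms(2), of \<nu>] by (simp add: bessel_ratio_def bessel_K_minus)
next
  case False
  then show ?thesis using assms bessel_K_lt_shift[of \<nu> x] bessel_K_pos[OF assms(2), of \<nu>]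
    by (simp add: bessel_ratio_def)
qed

lemma bessel_ratio_ge_1:
  assumes "0 < \<nu>" "\<nu> \<le> 1/2" "x > 0"
  shows "bessel_ratio \<nu> x \<ge> 1"
proof (cases "\<nu> = 1/2")
  case True
  then have "\<nu> - 1 = - \<nu>" by simp
  then have "bessel_K (\<nu> - 1) x = bessel_K \<nu> x" by (simp only: bessel_K_minus)
  then show ?thesis using bessel_K_pos[OF assms(3), of \<nu>] by (simp add: bessel_ratio_def bessel_K_minus)
next
  case False
  then show ?thesis using assms bessel_K_strict_mono[of x \<nu> "\<nu> - 1"] bessel_K_pos[OF assms(3), of \<nu>]
    by (simp add: bessel_ratio_def)
qed

text \<open>The logarithmic derivative of the kernel is minus the ratio, hence at least - 1, so the
  kernel times \<open>exp x\<close> is nondecreasing.\<close>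

lemma bessel_kernel_le_exp:
  assumes \<nu>: "\<nu> \<ge> 1/2" and x: "0 < x" "x \<le> y"
  shows "bessel_kernel \<nu> x \<le> bessel_kernel \<nu> y * exp (y - x)"
proof -
  have "bessel_kernel \<nu> x * exp x \<le> bessel_kernel \<nu> y * exp y"
  proof (rule DERIV_nonneg_imp_nondecreasing[OF x(2)])
    fix t assume "x \<le> t"
    then have t: "t > 0" using x by simp
    have "DERIV (\<lambda>x. bessel_kernel \<nu> x * exp x) t :> - bessel_kernel \<nu> t * bessel_ratio \<nu> t * exp t + exp t * bessel_kernel \<nu> t"
      by (rule DERIV_mult[OF bessel_kernel_DERIV[OF t] DERIV_exp])
    moreover have "- bessel_kernel \<nu> t * bessel_ratio \<nu> t * exp t + exp t * bessel_kernel \<nu> t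
        = bessel_kernel \<nu> t * exp t * (1 - bessel_ratio \<nu> t)" by (simp add: algebra_simps)
    moreover have "\<dots> \<ge> 0" using bessel_kernel_pos[OF t, of \<nu>] bessel_ratio_le_1[OF \<nu> t] by simp
    ultimately show "\<exists>D. DERIV (\<lambda>x. bessel_kernel \<nu> x * exp x) t :> D \<and> 0 \<le> D" by metis
  qed
  then show ?thesis by (simp add: exp_diff field_simps)
qed

text \<open>Only (0, 1] matters, since the kernel decreases. For \<nu> \<ge> 1/2 the previous lemma
  suffices. For smaller \<nu> the derivative is - x^(2\<nu> - 1) times the kernel of order 1 - \<nu>
  > 1/2, which is already bounded by some \<open>C\<close> there; the power is integrable at 0, and
  \<open>C / (2 * \<nu>) * x powr (2 * \<nu>)\<close> compensates it.\<close>

lemma bessel_kernel_bounded: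
  assumes \<nu>: "\<nu> > 0"
  shows "\<exists>C. \<forall>x>0. bessel_kernel \<nu> x \<le> C"
proof -
  have "\<exists>C. \<forall>x. 0 < x \<and> x \<le> 1 \<longrightarrow> bessel_kernel \<nu> x \<le> C"
  proof (cases "\<nu> \<ge> 1/2")
    case True
    have "bessel_kernel \<nu> x \<le> bessel_kernel \<nu> 1 * exp 1" if "0 < x" "x \<le> 1" for x
    proof -
      have "bessel_kernel \<nu> 1 * exp (1 - x) \<le> bessel_kernel \<nu> 1 * exp 1"
        using that bessel_kernel_pos[of 1 \<nu>] by simp
      with bessel_kernel_le_exp[OF True that] show ?thesis by linarith
    qed
    then show ?thesis by blast
  next
    case False
    define C where "C = bessel_kernel (1 - \<nu>) 1 * exp 1"
    have C: "bessel_kernel (1 - \<nu>) t \<le> C" if "0 < t" "t \<le> 1" for t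
    proof -
      have "bessel_kernel (1 - \<nu>) 1 * exp (1 - t) \<le> C"
        using that bessel_kernel_pos[of 1 "1 - \<nu>"] by (simp add: C_def)
      then show ?thesis using bessel_kernel_le_exp[of "1 - \<nu>" t 1] that False by simp
    qed
    let ?g = "\<lambda>x. bessel_kernel \<nu> x + C / (2 * \<nu>) * x powr (2 * \<nu>)"
    have "?g x \<le> ?g 1" if x: "0 < x" "x \<le> 1" for x
    proof (rule DERIV_nonneg_imp_nondecreasing[OF x(2)])
      fix t assume "x \<le> t" "t \<le> 1"
      then have t: "0 < t" "t \<le> 1" using x by auto
      have "DERIV (bessel_kernel \<nu>) t :> - (t powr \<nu> * bessel_K (\<nu> - 1) t)"
        using bessel_K_powr_DERIV[OF t(1), of \<nu>] by (simp add: bessel_kernel_def[abs_def])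
      then have "DERIV ?g t :> - (t powr \<nu> * bessel_K (\<nu> - 1) t) + C / (2 * \<nu>) * (2 * \<nu> * t powr (2 * \<nu> - 1))"
        by (intro DERIV_add DERIV_cmult has_real_derivative_powr t)
      moreover have "t powr \<nu> * bessel_K (\<nu> - 1) t = t powr (2 * \<nu> - 1) * bessel_kernel (1 - \<nu>) t"
        using bessel_K_minus[of "\<nu> - 1" t] by (simp add: bessel_kernel_def powr_add[symmetric] flip: mult.assoc)
      moreover have "\<dots> \<le> t powr (2 * \<nu> - 1) * C" using C[OF t] by (intro mult_left_mono) auto
      ultimately show "\<exists>D. DERIV ?g t :> D \<and> 0 \<le> D" using \<nu> by (intro exI conjI) (auto simp: mult.commute)
    qed
    moreover have "0 \<le> C / (2 * \<nu>) * x powr (2 * \<nu>)" for x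
      using \<nu> bessel_kernel_pos[of 1 "1 - \<nu>"] by (simp add: C_def)
    ultimately have "bessel_kernel \<nu> x \<le> ?g 1" if "0 < x" "x \<le> 1" for x
      using that by (smt (verit))
    then show ?thesis by (intro exI[of _ "?g 1"]) blast
  qed
  then obtain C where C: "\<And>x. 0 < x \<Longrightarrow> x \<le> 1 \<Longrightarrow> bessel_kernel \<nu> x \<le> C" by blast
  have "bessel_kernel \<nu> x \<le> C" if "x > 0" for x
  proof (cases "x \<le> 1")
    case False
    then show ?thesis using bessel_kernel_strict_antimono[of 1 x \<nu>] C[of 1] by simp
  qed (use C that in auto)
  then show ?thesis by blast
qed

text \<open>The limit of \<open>bessel_kernel \<nu>\<close> at \<open>0\<close>, meaningful for \<open>\<nu> > 0\<close> only.\<close>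

definition bessel_kernel_0 :: "real \<Rightarrow> real" where
  "bessel_kernel_0 \<nu> = (SUP x\<in>{0<..}. bessel_kernel \<nu> x)"

lemma bessel_kernel_less_0:
  assumes \<nu>: "\<nu> > 0" and x: "x > 0"
  shows "bessel_kernel \<nu> x < bessel_kernel_0 \<nu>"
proof -
  have "bessel_kernel \<nu> x < bessel_kernel \<nu> (x / 2)" using x by (intro bessel_kernel_strict_antimono) auto
  also have "\<dots> \<le> bessel_kernel_0 \<nu>"
    unfolding bessel_kernel_0_def using bessel_kernel_bounded[OF \<nu>] x
    by (intro cSUP_upper) (auto simp: bdd_above_def)
  finally show ?thesis .
qed

lemma bessel_kernel_tendsto_0:
  assumes \<nu>: "\<nu> > 0"
  shows "(bessel_kernel \<nu> \<longlongrightarrow> bessel_kernel_0 \<nu>) (at_right 0)"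
proof (rule order_tendstoI)
  fix a assume "a < bessel_kernel_0 \<nu>"
  then obtain x0 where x0: "x0 > 0" "a < bessel_kernel \<nu> x0"
    unfolding bessel_kernel_0_def using bessel_kernel_bounded[OF \<nu>]
    by (subst (asm) less_cSUP_iff) (auto simp: bdd_above_def)
  have "\<forall>\<^sub>F x in at_right 0. x \<in> {0<..<x0}" using x0 by (intro eventually_at_right_real)
  then show "\<forall>\<^sub>F x in at_right 0. a < bessel_kernel \<nu> x"
    by eventually_elim (use x0 bessel_kernel_strict_antimono[of _ x0 \<nu>] in force)
next
  fix a assume a: "bessel_kernel_0 \<nu> < a"
  show "\<forall>\<^sub>F x in at_right 0. bessel_kernel \<nu> x < a"
    using eventually_at_right_less[of 0] by eventually_elim (use a bessel_kernel_less_0[OF \<nu>] in force)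
qed

text \<open>For x < 1 and \<nu> \<le> 0 the power is at least 1, so it is enough that
  \<open>bessel_K\<close> itself exceeds \<open>C\<close>; \<open>bessel_K_lower\<close> with
  \<open>T > C\<close> gives this for small x.\<close>

lemma bessel_kernel_unbounded:
  assumes \<nu>: "\<nu> \<le> 0"
  shows "\<forall>\<^sub>F x in at_right 0. C < bessel_kernel \<nu> x"
proof -
  define T where "T = \<bar>C\<bar> + 1"
  have "((\<lambda>x. T * exp (- (x * cosh T))) \<longlongrightarrow> T * exp (- (0 * cosh T))) (at_right 0)"
    by (intro tendsto_intros)
  then have "\<forall>\<^sub>F x in at_right 0. C < T * exp (- (x * cosh T))"
    by (rule order_tendstoD) (auto simp: T_def)
  moreover have "\<forall>\<^sub>F x in at_right 0. x \<in> {0<..<1::real}" by (intro eventually_at_right_real) auto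
  ultimately show ?thesis
  proof eventually_elim
    case (elim x)
    have "C < bessel_K \<nu> x" using elim bessel_K_lower[of x T \<nu>] by (auto simp: T_def)
    moreover have "1 \<le> x powr \<nu>"
      using elim \<nu> powr_mono'[of \<nu> 0 x] by simp
    then have "1 * bessel_K \<nu> x \<le> x powr \<nu> * bessel_K \<nu> x"
      using bessel_K_pos[of x \<nu>] elim by (intro mult_right_mono) auto
    ultimately show ?case unfolding bessel_kernel_def by linarith
  qed
qed

section \<open>Integrability and the first moment on a half-line\<close>

lemma integral_split_reflect:
  fixes f :: "real \<Rightarrow> real"
  assumes f: "set_integrable lborel {0<..} f" and g: "set_integrable lborel {0<..} (\<lambda>x. f (- x))"
  shows "integrable lborel f"
    and "(\<integral>x. f x \<partial>lborel) = (LBINT x:{0<..}. f x) + (LBINT x:{0<..}. f (- x))"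
proof -
  have 1: "has_bochner_integral lborel (\<lambda>x. indicator {0<..} x *\<^sub>R f x) (LBINT x:{0<..}. f x)"
    using f by (simp add: has_bochner_integral_iff set_integrable_def set_lebesgue_integral_def)
  have "has_bochner_integral lborel (\<lambda>x. indicator {0<..} x *\<^sub>R f (- x)) (LBINT x:{0<..}. f (- x))"
    using g by (simp add: has_bochner_integral_iff set_integrable_def set_lebesgue_integral_def)
  then have 2: "has_bochner_integral lborel (\<lambda>x. indicator {0<..} (- x) *\<^sub>R f x) (LBINT x:{0<..}. f (- x))"
    by (subst lborel_has_bochner_integral_real_affine_iff[where c="-1" and t=0]) auto
  have "has_bochner_integral lborel f ((LBINT x:{0<..}. f x) + (LBINT x:{0<..}. f (- x)))"
    by (rule has_bochner_integral_discrete_difference[where X="{0}", THEN iffD1, rotated 4, OF has_bochner_integral_add[OF 1 2]])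
      (auto split: split_indicator)
  then show "integrable lborel f" "(\<integral>x. f x \<partial>lborel) = (LBINT x:{0<..}. f x) + (LBINT x:{0<..}. f (- x))"
    by (auto simp: has_bochner_integral_iff)
qed

text \<open>Up to a constant this is the density on the positive half-line. The negative half-line,
  reflected, has the same form with - \<beta> for \<beta>, so every integral is computed once for
  both signs.\<close>

definition vg_half :: "real \<Rightarrow> real \<Rightarrow> real \<Rightarrow> real \<Rightarrow> real" where
  "vg_half \<nu> c \<beta> x = exp (\<beta> * x) * bessel_kernel \<nu> (c * x)"

lemma vg_half_pos: "c > 0 \<Longrightarrow> x > 0 \<Longrightarrow> vg_half \<nu> c \<beta> x > 0"
  by (simp add: vg_half_def bessel_kernel_pos)

lemma vg_half_DERIV:
  assumes "c > 0" "x > 0"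
  shows "DERIV (vg_half \<nu> c \<beta>) x :> vg_half \<nu> c \<beta> x * (\<beta> - c * bessel_ratio \<nu> (c * x))"
proof -
  have "c * x > 0" using assms by simp
  from DERIV_chain2[OF bessel_kernel_DERIV[OF this, of \<nu>] DERIV_cmult_Id[of c]]
  have 1: "DERIV (\<lambda>x. bessel_kernel \<nu> (c * x)) x :> - bessel_kernel \<nu> (c * x) * bessel_ratio \<nu> (c * x) * c" .
  have 2: "DERIV (\<lambda>x. exp (\<beta> * x)) x :> exp (\<beta> * x) * \<beta>"
    by (rule DERIV_fun_exp[OF DERIV_cmult_Id])
  show ?thesis unfolding vg_half_def[abs_def]
    by (rule DERIV_cong[OF DERIV_mult[OF 2 1]]) (simp add: algebra_simps)
qed

lemma vg_half_tendsto_0: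
  assumes "\<nu> > 0" "c > 0"
  shows "(vg_half \<nu> c \<beta> \<longlongrightarrow> bessel_kernel_0 \<nu>) (at_right 0)"
proof -
  have "filterlim (\<lambda>x. c * x) (at_right 0) (at_right 0)"
    unfolding filterlim_at
  proof
    have "((\<lambda>x. c * x) \<longlongrightarrow> c * 0) (at_right 0)" by (intro tendsto_intros)
    then show "((\<lambda>x. c * x) \<longlongrightarrow> 0) (at_right 0)" by simp
    show "\<forall>\<^sub>F x in at_right 0. c * x \<in> {0<..} \<and> c * x \<noteq> 0"
      using eventually_at_right_less[of 0] by eventually_elim (use assms in auto)
  qed
  then have "((\<lambda>x. bessel_kernel \<nu> (c * x)) \<longlongrightarrow> bessel_kernel_0 \<nu>) (at_right 0)"
    by (rule filterlim_compose[OF bessel_kernel_tendsto_0[OF assms(1)]])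
  moreover have "((\<lambda>x. exp (\<beta> * x)) \<longlongrightarrow> exp (\<beta> * 0)) (at_right 0)" by (intro tendsto_intros)
  ultimately have "((\<lambda>x. exp (\<beta> * x) * bessel_kernel \<nu> (c * x)) \<longlongrightarrow> exp (\<beta> * 0) * bessel_kernel_0 \<nu>) (at_right 0)"
    by (intro tendsto_mult)
  then show ?thesis by (simp add: vg_half_def[abs_def])
qed

lemma vg_half_le:
  assumes "c > 0" "x \<ge> 1 / c"
  shows "vg_half \<nu> c \<beta> x \<le> exp 1 * bessel_K \<nu> 1 * ((c * x) powr \<nu> * exp (- (c - \<beta>) * x))"
proof -
  have "c * x \<ge> 1" using assms by (simp add: field_simps)
  then have "bessel_K \<nu> (c * x) \<le> exp (- (c * x - 1)) * bessel_K \<nu> 1" by (intro bessel_K_decay) auto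
  then have "vg_half \<nu> c \<beta> x \<le> exp (\<beta> * x) * ((c * x) powr \<nu> * (exp (- (c * x - 1)) * bessel_K \<nu> 1))"
    unfolding vg_half_def bessel_kernel_def by (intro mult_left_mono) auto
  also have "\<dots> = exp (\<beta> * x + (1 - c * x)) * (c * x) powr \<nu> * bessel_K \<nu> 1"
    by (subst exp_add) simp
  also have "\<beta> * x + (1 - c * x) = 1 + - (c - \<beta>) * x" by (simp add: algebra_simps)
  also have "exp (1 + - (c - \<beta>) * x) = exp 1 * exp (- (c - \<beta>) * x)" by (rule exp_add)
  finally show ?thesis by (simp add: mult_ac)
qed

text \<open>The weight is chosen so that boundedness of the product dominates both
  \<open>vg_half\<close> and \<open>x * vg_half\<close> by a multiple of 1 / (1 + x^2); it also
  controls the boundary term in \<open>vg_half_moment\<close>.\<close>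

lemma vg_half_decay:
  assumes "c > 0" "\<beta> < c"
  shows "((\<lambda>x. (1 + x) * (1 + x\<^sup>2) * vg_half \<nu> c \<beta> x) \<longlongrightarrow> 0) at_top"
proof (rule tendsto_sandwich[of "\<lambda>_. 0"])
  define \<delta> where "\<delta> = c - \<beta>"
  have \<delta>: "\<delta> > 0" using assms by (simp add: \<delta>_def)
  show "((\<lambda>x. (1 + x) * (1 + x\<^sup>2) * (exp 1 * bessel_K \<nu> 1 * ((c * x) powr \<nu> * exp (- \<delta> * x)))) \<longlongrightarrow> 0) at_top"
    using \<delta> assms by real_asymp
  show "((\<lambda>_. 0) \<longlongrightarrow> (0::real)) (at_top :: real filter)" by simp
  show "\<forall>\<^sub>F x in at_top. 0 \<le> (1 + x) * (1 + x\<^sup>2) * vg_half \<nu> c \<beta> x"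
    using eventually_gt_at_top[of 0]
  proof eventually_elim
    case (elim x)
    then show ?case using vg_half_pos[OF assms(1) elim, of \<nu> \<beta>] by simp
  qed
  show "\<forall>\<^sub>F x in at_top. (1 + x) * (1 + x\<^sup>2) * vg_half \<nu> c \<beta> x
      \<le> (1 + x) * (1 + x\<^sup>2) * (exp 1 * bessel_K \<nu> 1 * ((c * x) powr \<nu> * exp (- \<delta> * x)))"
    using eventually_ge_at_top[of "1 / c"] eventually_gt_at_top[of 0]
  proof eventually_elim
    case (elim x)
    show ?case unfolding \<delta>_def using elim by (intro mult_left_mono vg_half_le assms) auto
  qed
qed

text \<open>One constant \<open>C\<close> bounds the weighted function on the whole half-line:
  beyond \<open>X\<close> by the decay at infinity, and on (0, X) by the finite limit of the kernel
  at 0, which is where \<nu> > 0 enters.\<close>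

lemma vg_half_integrable:
  assumes \<nu>: "\<nu> > 0" and c: "c > 0" "\<beta> < c"
  shows "set_integrable lborel {0<..} (vg_half \<nu> c \<beta>)"
    and "set_integrable lborel {0<..} (\<lambda>x. x * vg_half \<nu> c \<beta> x)"
proof -
  have "\<forall>\<^sub>F x in at_top. (1 + x) * (1 + x\<^sup>2) * vg_half \<nu> c \<beta> x < 1"
    using order_tendstoD(2)[OF vg_half_decay[OF c, of \<nu>], of 1] by simp
  then obtain X0 where X0: "\<And>x. x \<ge> X0 \<Longrightarrow> (1 + x) * (1 + x\<^sup>2) * vg_half \<nu> c \<beta> x < 1"
    unfolding eventually_at_top_linorder by blast
  define X where "X = max X0 0"
  define C where "C = 1 + (1 + X) * (1 + X\<^sup>2) * (exp (\<bar>\<beta>\<bar> * X) * bessel_kernel_0 \<nu>)"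
  have k0: "bessel_kernel_0 \<nu> > 0"
    using bessel_kernel_less_0[OF \<nu>, of 1] bessel_kernel_pos[of 1 \<nu>] by simp
  have bound: "(1 + x) * (1 + x\<^sup>2) * vg_half \<nu> c \<beta> x \<le> C" if x: "x > 0" for x
  proof (cases "x \<ge> X")
    case True
    have "0 \<le> (1 + X) * (1 + X\<^sup>2) * (exp (\<bar>\<beta>\<bar> * X) * bessel_kernel_0 \<nu>)"
      using k0 by (auto simp: X_def intro!: mult_nonneg_nonneg)
    then show ?thesis using True X0[of x] by (simp add: C_def X_def)
  next
    case False
    then have xX: "x \<le> X" by simp
    have "\<beta> * x \<le> \<bar>\<beta>\<bar> * X" using xX x by (intro mult_mono) auto
    then have "vg_half \<nu> c \<beta> x \<le> exp (\<bar>\<beta>\<bar> * X) * bessel_kernel_0 \<nu>"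
      unfolding vg_half_def using bessel_kernel_less_0[OF \<nu>, of "c * x"] c x k0 bessel_kernel_pos[of "c * x" \<nu>]
      by (intro mult_mono) auto
    then have "(1 + x) * (1 + x\<^sup>2) * vg_half \<nu> c \<beta> x \<le> (1 + X) * (1 + X\<^sup>2) * (exp (\<bar>\<beta>\<bar> * X) * bessel_kernel_0 \<nu>)"
      using xX x vg_half_pos[OF c(1) x, of \<nu> \<beta>] by (intro mult_mono power_mono add_mono) auto
    then show ?thesis by (simp add: C_def)
  qed
  have dom: "set_integrable lborel {0<..} (\<lambda>x. C * inverse (1 + x\<^sup>2))"
    by (intro set_integrable_mult_right set_integrable_subset[OF integrable_inverse_1_plus_square]) auto
  have cont: "continuous_on {0<..} (vg_half \<nu> c \<beta>)"
    using vg_half_DERIV[OF c(1)] by (intro continuous_at_imp_continuous_on) (auto intro: DERIV_isCont)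
  have le: "(1 + x) * vg_half \<nu> c \<beta> x \<le> C * inverse (1 + x\<^sup>2)" if "x > 0" for x
  proof -
    have "1 + x\<^sup>2 > 0" by (simp add: add_pos_nonneg)
    then show ?thesis using bound[OF that] by (simp add: field_simps)
  qed
  show "set_integrable lborel {0<..} (vg_half \<nu> c \<beta>)"
  proof (rule set_integrable_bound[OF dom])
    show "set_borel_measurable lborel {0<..} (vg_half \<nu> c \<beta>)"
      unfolding set_borel_measurable_def using borel_measurable_continuous_on_indicator[OF _ cont] by simp
    show "AE x in lborel. x \<in> {0<..} \<longrightarrow> norm (vg_half \<nu> c \<beta> x) \<le> norm (C * inverse (1 + x\<^sup>2))"
    proof (intro AE_I2 impI)
      fix x :: real assume "x \<in> {0<..}"
      then have x: "x > 0" by simp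
      have "vg_half \<nu> c \<beta> x > 0" using vg_half_pos[OF c(1) x] .
      moreover have "x * vg_half \<nu> c \<beta> x > 0" using calculation x by simp
      ultimately show "norm (vg_half \<nu> c \<beta> x) \<le> norm (C * inverse (1 + x\<^sup>2))"
        using le[OF x] unfolding real_norm_def distrib_right mult_1_left by linarith
    qed
  qed
  show "set_integrable lborel {0<..} (\<lambda>x. x * vg_half \<nu> c \<beta> x)"
  proof (rule set_integrable_bound[OF dom])
    have "continuous_on {0<..} (\<lambda>x. x * vg_half \<nu> c \<beta> x)" by (intro continuous_intros cont)
    then show "set_borel_measurable lborel {0<..} (\<lambda>x. x * vg_half \<nu> c \<beta> x)"
      unfolding set_borel_measurable_def using borel_measurable_continuous_on_indicator[of "{0<..}"] by force
    show "AE x in lborel. x \<in> {0<..} \<longrightarrow> norm (x * vg_half \<nu> c \<beta> x) \<le> norm (C * inverse (1 + x\<^sup>2))"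
    proof (intro AE_I2 impI)
      fix x :: real assume "x \<in> {0<..}"
      then have x: "x > 0" by simp
      have "vg_half \<nu> c \<beta> x > 0" using vg_half_pos[OF c(1) x] .
      moreover have "x * vg_half \<nu> c \<beta> x > 0" using calculation x by simp
      ultimately show "norm (x * vg_half \<nu> c \<beta> x) \<le> norm (C * inverse (1 + x\<^sup>2))"
        using le[OF x] unfolding real_norm_def distrib_right mult_1_left by linarith
    qed
  qed
qed

text \<open>The fundamental theorem of calculus applied to \<open>?H\<close>: as the ratio lies in
  (0, 1], the boundary value is 0 at infinity and minus 2\<nu> \<open>bessel_kernel_0 \<nu>\<close>
  at 0. The latter does not depend on \<beta>, so it cancels when the half-lines for \<beta> and -
  \<beta> are subtracted.\<close>

lemma vg_half_moment:
  assumes \<nu>: "\<nu> > 1/2" and c: "c > 0" "\<beta> < c"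
  shows "(c\<^sup>2 - \<beta>\<^sup>2) * (LBINT x:{0<..}. x * vg_half \<nu> c \<beta> x)
       = (2 * \<nu> + 1) * \<beta> * (LBINT x:{0<..}. vg_half \<nu> c \<beta> x) + 2 * \<nu> * bessel_kernel_0 \<nu>"
proof -
  let ?h = "vg_half \<nu> c \<beta>"
  let ?R = "\<lambda>x. bessel_ratio \<nu> (c * x)"
  txt \<open>\<open>?H\<close> is \<open>x h' - 2\<nu>h - 2\<beta>xh\<close>; its derivative comes from the second-order equation of \<open>h\<close>.\<close>
  let ?H = "\<lambda>x. - (?h x * (\<beta> * x + c * x * ?R x + 2 * \<nu>))"
  let ?f = "\<lambda>x. (c\<^sup>2 - \<beta>\<^sup>2) * (x * ?h x) - (2 * \<nu> + 1) * \<beta> * ?h x"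
  have \<nu>0: "\<nu> > 0" using \<nu> by simp
  have R: "0 < ?R x" "?R x \<le> 1" if "x > 0" for x
    using bessel_ratio_pos[of "c * x" \<nu>] bessel_ratio_le_1[of \<nu> "c * x"] \<nu> c that by auto
  note int = vg_half_integrable[OF \<nu>0 c]
  have "(LBINT x=ereal 0..\<infinity>. ?f x) = 0 - (- (2 * \<nu> * bessel_kernel_0 \<nu>))"
  proof (rule interval_integral_FTC_integrable)
    fix x assume "ereal 0 < ereal x"
    then have x: "x > 0" by simp
    have cx: "c * x > 0" using c x by simp
    have DR: "DERIV ?R x :> ((?R x)\<^sup>2 + (2 * \<nu> - 1) / (c * x) * ?R x - 1) * c"
      using DERIV_chain2[OF bessel_ratio_DERIV[OF cx, of \<nu>] DERIV_cmult_Id[of c]] .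
    have "DERIV (\<lambda>x. \<beta> * x + c * x * ?R x + 2 * \<nu>) x :>
        \<beta> + (c * ?R x + ((?R x)\<^sup>2 + (2 * \<nu> - 1) / (c * x) * ?R x - 1) * c * (c * x)) + 0"
      by (intro DERIV_add DERIV_mult DERIV_const DERIV_cmult_Id DR)
    from DERIV_minus[OF DERIV_mult[OF vg_half_DERIV[OF c(1) x, of \<nu> \<beta>] this]]
    have "DERIV ?H x :> ?f x"
    proof (rule DERIV_cong)
      show "- (?h x * (\<beta> - c * ?R x) * (\<beta> * x + c * x * ?R x + 2 * \<nu>) +
          (\<beta> + (c * ?R x + ((?R x)\<^sup>2 + (2 * \<nu> - 1) / (c * x) * ?R x - 1) * c * (c * x)) + 0) * ?h x) = ?f x"
        using x c(1) by (simp add: divide_simps) (simp add: algebra_simps power2_eq_square)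
    qed
    then show "(?H has_vector_derivative ?f x) (at x)"
      by (simp add: has_real_derivative_iff_has_vector_derivative)
    show "isCont ?f x"
      using DERIV_isCont[OF vg_half_DERIV[OF c(1) x]] by (intro continuous_intros)
  next
    show "set_integrable lborel (einterval (ereal 0) \<infinity>) ?f"
      using int by (auto intro!: set_integral_diff set_integrable_mult_right)
    have "((\<lambda>x. c * x * ?R x) \<longlongrightarrow> 0) (at_right 0)"
    proof (rule tendsto_sandwich[of "\<lambda>_. 0" _ _ "\<lambda>x. c * x"])
      show "((\<lambda>x. c * x) \<longlongrightarrow> 0) (at_right 0)" by (auto intro!: tendsto_eq_intros)
      show "\<forall>\<^sub>F x in at_right 0. 0 \<le> c * x * ?R x"
        using eventually_at_right_less[of 0] by eventually_elim (use c R less_imp_le in \<open>auto intro!: mult_nonneg_nonneg less_imp_le\<close>)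
      show "\<forall>\<^sub>F x in at_right 0. c * x * ?R x \<le> c * x"
        using eventually_at_right_less[of 0] by eventually_elim (use c R in \<open>auto intro!: mult_left_le\<close>)
    qed simp
    then have "(?H \<longlongrightarrow> - (bessel_kernel_0 \<nu> * (\<beta> * 0 + 0 + 2 * \<nu>))) (at_right 0)"
      by (intro tendsto_intros vg_half_tendsto_0[OF \<nu>0 c(1)])
    then have "(?H \<longlongrightarrow> - (2 * \<nu> * bessel_kernel_0 \<nu>)) (at_right 0)" by (simp add: mult_ac)
    then show "((?H \<circ> real_of_ereal) \<longlongrightarrow> - (2 * \<nu> * bessel_kernel_0 \<nu>)) (at_right (ereal 0))"
      by (simp only: ereal_tendsto_simps1)
    have "(?H \<longlongrightarrow> 0) at_top"
    proof (rule tendsto_0_le[OF vg_half_decay[OF c, of \<nu>], where K = "\<bar>\<beta>\<bar> + c + 2 * \<nu>"])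
      show "\<forall>\<^sub>F x in at_top. norm (?H x) \<le> norm ((1 + x) * (1 + x\<^sup>2) * ?h x) * (\<bar>\<beta>\<bar> + c + 2 * \<nu>)"
        using eventually_gt_at_top[of 0]
      proof eventually_elim
        case (elim x)
        have h: "?h x > 0" using vg_half_pos[OF c(1) elim] .
        have 1: "\<bar>\<beta> * x\<bar> \<le> \<bar>\<beta>\<bar> * (1 + x)" using elim by (simp add: abs_mult mult_left_mono)
        have 2: "0 \<le> c * x * ?R x" "c * x * ?R x \<le> c * x" using R[OF elim] elim c by (auto intro!: mult_left_le)
        have 3: "c * x \<le> c * (1 + x)" using c by simp
        have 4: "2 * \<nu> \<le> 2 * \<nu> * (1 + x)" using \<nu> elim by simp
        have "\<bar>\<beta> * x + c * x * ?R x + 2 * \<nu>\<bar> \<le> \<bar>\<beta>\<bar> * (1 + x) + c * (1 + x) + 2 * \<nu> * (1 + x)"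
          using 1 2 3 4 \<nu> by linarith
        also have "\<dots> = (1 + x) * 1 * (\<bar>\<beta>\<bar> + c + 2 * \<nu>)" by (simp add: algebra_simps)
        also have "\<dots> \<le> (1 + x) * (1 + x\<^sup>2) * (\<bar>\<beta>\<bar> + c + 2 * \<nu>)"
          using elim c \<nu> by (intro mult_right_mono mult_left_mono) auto
        finally have "?h x * \<bar>\<beta> * x + c * x * ?R x + 2 * \<nu>\<bar> \<le> ?h x * ((1 + x) * (1 + x\<^sup>2) * (\<bar>\<beta>\<bar> + c + 2 * \<nu>))"
          using h by (intro mult_left_mono) auto
        moreover have "norm ((1 + x) * (1 + x\<^sup>2) * ?h x) = (1 + x) * (1 + x\<^sup>2) * ?h x"
          using h elim by simp
        moreover have "norm (?H x) = ?h x * \<bar>\<beta> * x + c * x * ?R x + 2 * \<nu>\<bar>"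
          using h by (simp add: abs_mult)
        ultimately show ?case by (simp only: mult_ac)
      qed
    qed
    then show "((?H \<circ> real_of_ereal) \<longlongrightarrow> 0) (at_left \<infinity>)" by (simp only: ereal_tendsto_simps1)
  qed auto
  moreover have "(LBINT x=ereal 0..\<infinity>. ?f x) =
      (c\<^sup>2 - \<beta>\<^sup>2) * (LBINT x:{0<..}. x * ?h x) - (2 * \<nu> + 1) * \<beta> * (LBINT x:{0<..}. ?h x)"
    unfolding interval_integral_to_infinity_eq
    by (simp add: set_integral_diff set_integrable_mult_right int)
  ultimately show ?thesis by simp
qed

section \<open>The mode\<close>

definition vg_rate :: "real \<Rightarrow> real \<Rightarrow> real" where
  "vg_rate \<theta> \<sigma> = sqrt (\<theta>\<^sup>2 + \<sigma>\<^sup>2) / \<sigma>\<^sup>2"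

definition vg_ratio :: "real \<Rightarrow> real \<Rightarrow> real" where
  "vg_ratio \<theta> \<sigma> = \<theta> / sqrt (\<theta>\<^sup>2 + \<sigma>\<^sup>2)"

text \<open>The prefactor that remains when the base of the power is rescaled to
  \<open>vg_rate \<theta> \<sigma> * \<bar>x\<bar>\<close>, so that power and Bessel function share
  one argument and form \<open>bessel_kernel\<close>.\<close>

definition vg_const :: "real \<Rightarrow> real \<Rightarrow> real \<Rightarrow> real" where
  "vg_const r \<theta> \<sigma> =
     1 / (\<sigma> * sqrt pi * Gamma (r / 2)) * (\<sigma>\<^sup>2 / (2 * (\<theta>\<^sup>2 + \<sigma>\<^sup>2))) powr ((r - 1) / 2)"

context
  fixes \<theta> \<sigma> :: real
  assumes \<theta>: "\<theta> > 0" and \<sigma>: "\<sigma> > 0"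
begin

lemma vg_sqrt_pos: "sqrt (\<theta>\<^sup>2 + \<sigma>\<^sup>2) > 0"
  using \<theta> by (simp add: add_pos_nonneg)

lemma vg_rate_pos: "vg_rate \<theta> \<sigma> > 0"
  using vg_sqrt_pos \<sigma> by (simp add: vg_rate_def)

lemma vg_ratio_bounds: "0 < vg_ratio \<theta> \<sigma>" "vg_ratio \<theta> \<sigma> < 1"
proof -
  have "\<theta> < sqrt (\<theta>\<^sup>2 + \<sigma>\<^sup>2)" using \<sigma> by (intro real_less_rsqrt) simp
  then show "0 < vg_ratio \<theta> \<sigma>" "vg_ratio \<theta> \<sigma> < 1"
    using vg_sqrt_pos \<theta> by (simp_all add: vg_ratio_def)
qed

lemma vg_tilt_eq: "\<theta> / \<sigma>\<^sup>2 = vg_rate \<theta> \<sigma> * vg_ratio \<theta> \<sigma>"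
  using vg_sqrt_pos by (simp add: vg_rate_def vg_ratio_def)

lemma vg_tilt_less: "\<theta> / \<sigma>\<^sup>2 < vg_rate \<theta> \<sigma>"
  unfolding vg_tilt_eq using vg_rate_pos vg_ratio_bounds by simp

lemma vg_ratio_sq: "1 - (vg_ratio \<theta> \<sigma>)\<^sup>2 = \<sigma>\<^sup>2 / (\<theta>\<^sup>2 + \<sigma>\<^sup>2)"
proof -
  have "\<theta>\<^sup>2 + \<sigma>\<^sup>2 > 0" using \<theta> by (simp add: add_pos_nonneg)
  then have "\<theta>\<^sup>2 / (\<theta>\<^sup>2 + \<sigma>\<^sup>2) + \<sigma>\<^sup>2 / (\<theta>\<^sup>2 + \<sigma>\<^sup>2) = 1"
    unfolding add_divide_distrib[symmetric] by (auto intro: divide_self)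
  moreover have "(vg_ratio \<theta> \<sigma>)\<^sup>2 = \<theta>\<^sup>2 / (\<theta>\<^sup>2 + \<sigma>\<^sup>2)"
    by (simp add: vg_ratio_def power_divide)
  ultimately show ?thesis by linarith
qed

text \<open>Converts the roots of the Amos equations, which are multiples of \<kappa> / (1 -
  \<kappa>^2), into multiples of \<theta> once the factor \<open>vg_rate \<theta> \<sigma>\<close>
  is divided out.\<close>

lemma vg_ratio_scaling: "vg_ratio \<theta> \<sigma> / (1 - (vg_ratio \<theta> \<sigma>)\<^sup>2) = vg_rate \<theta> \<sigma> * \<theta>"
proof -
  have p: "\<theta>\<^sup>2 + \<sigma>\<^sup>2 > 0" using \<theta> by (simp add: add_pos_nonneg)
  define S where "S = sqrt (\<theta>\<^sup>2 + \<sigma>\<^sup>2)"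
  have S: "\<theta>\<^sup>2 + \<sigma>\<^sup>2 = S\<^sup>2" "S > 0" using p by (auto simp: S_def)
  show ?thesis unfolding vg_ratio_sq unfolding vg_ratio_def vg_rate_def S(1)
    using S(2) \<sigma> by (simp add: power2_eq_square)
qed

lemma vg_rate_sq_diff: "(vg_rate \<theta> \<sigma>)\<^sup>2 - (\<theta> / \<sigma>\<^sup>2)\<^sup>2 = 1 / \<sigma>\<^sup>2"
proof -
  have "\<theta>\<^sup>2 + \<sigma>\<^sup>2 > 0" using \<theta> by (simp add: add_pos_nonneg)
  then have "(vg_rate \<theta> \<sigma>)\<^sup>2 = (\<theta>\<^sup>2 + \<sigma>\<^sup>2) / (\<sigma>\<^sup>2)\<^sup>2" unfolding vg_rate_def power_divide by simp
  then have "(vg_rate \<theta> \<sigma>)\<^sup>2 - (\<theta> / \<sigma>\<^sup>2)\<^sup>2 = \<sigma>\<^sup>2 / (\<sigma>\<^sup>2)\<^sup>2"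
    unfolding power_divide by (simp only: diff_divide_distrib[symmetric] add_diff_cancel_left')
  also have "\<dots> = 1 / \<sigma>\<^sup>2" using \<sigma> by (simp add: power2_eq_square)
  finally show ?thesis .
qed

context
  fixes r :: real
  assumes r: "r > 0"
begin

section \<open>The density through the kernel: derivative, reflection, behaviour at 0\<close>

lemma vg_const_pos: "vg_const r \<theta> \<sigma> > 0"
proof -
  have "\<sigma>\<^sup>2 / (2 * (\<theta>\<^sup>2 + \<sigma>\<^sup>2)) > 0" using \<theta> \<sigma> by (intro divide_pos_pos) (auto intro: add_pos_pos)
  then show ?thesis
    using \<sigma> Gamma_real_pos[of "r / 2"] r unfolding vg_const_def by (intro mult_pos_pos divide_pos_pos) auto
qed

lemma vg_formula_eq:
  "vg_formula r \<theta> \<sigma> x =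
     vg_const r \<theta> \<sigma> * (exp (\<theta> / \<sigma>\<^sup>2 * x) * bessel_kernel ((r - 1) / 2) (vg_rate \<theta> \<sigma> * \<bar>x\<bar>))"
proof -
  let ?s = "sqrt (\<theta>\<^sup>2 + \<sigma>\<^sup>2)"
  have p: "\<theta>\<^sup>2 + \<sigma>\<^sup>2 > 0" using \<theta> by (simp add: add_pos_nonneg)
  then have eq: "\<bar>x\<bar> / (2 * ?s) = (\<sigma>\<^sup>2 / (2 * (\<theta>\<^sup>2 + \<sigma>\<^sup>2))) * (vg_rate \<theta> \<sigma> * \<bar>x\<bar>)"
  proof -
    define S where "S = ?s"
    have S: "\<theta>\<^sup>2 + \<sigma>\<^sup>2 = S\<^sup>2" "S > 0" using p by (auto simp: S_def)
    show ?thesis unfolding vg_rate_def S_def[symmetric] S(1) using S(2) \<sigma> by (simp add: power2_eq_square)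
  qed
  have "(\<bar>x\<bar> / (2 * ?s)) powr ((r - 1) / 2) =
      (\<sigma>\<^sup>2 / (2 * (\<theta>\<^sup>2 + \<sigma>\<^sup>2))) powr ((r - 1) / 2) * (vg_rate \<theta> \<sigma> * \<bar>x\<bar>) powr ((r - 1) / 2)"
    unfolding eq by (rule powr_mult)
  then show ?thesis unfolding vg_formula_def vg_const_def bessel_kernel_def vg_rate_def[symmetric] by simp
qed

lemma vg_density_pos_eq:
  "x > 0 \<Longrightarrow> vg_density r \<theta> \<sigma> x = vg_const r \<theta> \<sigma> * vg_half ((r - 1) / 2) (vg_rate \<theta> \<sigma>) (\<theta> / \<sigma>\<^sup>2) x"
  by (simp add: vg_density_def vg_formula_eq vg_half_def)

lemma vg_density_neg_eq:
  "x > 0 \<Longrightarrow> vg_density r \<theta> \<sigma> (- x) = vg_const r \<theta> \<sigma> * vg_half ((r - 1) / 2) (vg_rate \<theta> \<sigma>) (- (\<theta> / \<sigma>\<^sup>2)) x"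
  by (simp add: vg_density_def vg_formula_eq vg_half_def)

text \<open>The points x and - x differ only in the exponential factor. Hence no negative point can
  be a maximum.\<close>

lemma vg_density_reflect:
  assumes x: "x > 0"
  shows "vg_density r \<theta> \<sigma> (- x) < vg_density r \<theta> \<sigma> x"
proof -
  have "vg_half ((r - 1) / 2) (vg_rate \<theta> \<sigma>) (- (\<theta> / \<sigma>\<^sup>2)) x < vg_half ((r - 1) / 2) (vg_rate \<theta> \<sigma>) (\<theta> / \<sigma>\<^sup>2) x"
    unfolding vg_half_def using x \<theta> \<sigma> vg_rate_pos by (intro mult_strict_right_mono bessel_kernel_pos) auto
  then show ?thesis using vg_const_pos by (simp add: vg_density_pos_eq vg_density_neg_eq x)
qed

lemma vg_density_DERIV:
  assumes x: "x > 0"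
  shows "DERIV (vg_density r \<theta> \<sigma>) x :> vg_rate \<theta> \<sigma> * vg_density r \<theta> \<sigma> x *
     (vg_ratio \<theta> \<sigma> - bessel_ratio ((r - 1) / 2) (vg_rate \<theta> \<sigma> * x))"
proof -
  let ?h = "vg_half ((r - 1) / 2) (vg_rate \<theta> \<sigma>) (\<theta> / \<sigma>\<^sup>2)"
  have "DERIV (\<lambda>x. vg_const r \<theta> \<sigma> * ?h x) x :> vg_const r \<theta> \<sigma> *
     (?h x * (\<theta> / \<sigma>\<^sup>2 - vg_rate \<theta> \<sigma> * bessel_ratio ((r - 1) / 2) (vg_rate \<theta> \<sigma> * x)))"
    by (intro DERIV_cmult vg_half_DERIV vg_rate_pos x)
  then have "DERIV (\<lambda>x. vg_const r \<theta> \<sigma> * ?h x) x :> vg_rate \<theta> \<sigma> * vg_density r \<theta> \<sigma> x *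
     (vg_ratio \<theta> \<sigma> - bessel_ratio ((r - 1) / 2) (vg_rate \<theta> \<sigma> * x))"
    by (rule DERIV_cong) (simp only: vg_density_pos_eq[OF x], simp add: vg_tilt_eq algebra_simps)
  moreover have "\<forall>\<^sub>F y in nhds x. vg_density r \<theta> \<sigma> y = vg_const r \<theta> \<sigma> * ?h y"
    using eventually_nhds_in_open[of "{0<..}" x] x by (auto elim!: eventually_mono simp: vg_density_pos_eq)
  ultimately show ?thesis by (subst DERIV_cong_ev[OF refl _ refl]) 
qed

lemma vg_density_nonzero_pos:
  assumes "x \<noteq> 0"
  shows "vg_density r \<theta> \<sigma> x > 0"
  unfolding vg_density_def vg_formula_eq using assms
  by (auto intro!: mult_pos_pos vg_const_pos bessel_kernel_pos vg_rate_pos)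

lemma vg_formula_tendsto:
  assumes "r > 1"
  shows "(vg_formula r \<theta> \<sigma> \<longlongrightarrow> vg_const r \<theta> \<sigma> * bessel_kernel_0 ((r - 1) / 2)) (at 0)"
proof -
  have \<nu>: "(r - 1) / 2 > 0" using assms by simp
  note lim = tendsto_mult[OF tendsto_const vg_half_tendsto_0[OF \<nu> vg_rate_pos], of "vg_const r \<theta> \<sigma>"]
  have "(vg_formula r \<theta> \<sigma> \<longlongrightarrow> vg_const r \<theta> \<sigma> * bessel_kernel_0 ((r - 1) / 2)) (at_right 0)"
    by (rule Lim_transform_eventually[OF lim[of "\<theta> / \<sigma>\<^sup>2"]])
      (rule eventually_mono[OF eventually_at_right_less[of 0]], simp add: vg_formula_eq vg_half_def)
  moreover have "(vg_formula r \<theta> \<sigma> \<longlongrightarrow> vg_const r \<theta> \<sigma> * bessel_kernel_0 ((r - 1) / 2)) (at_left 0)"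
    unfolding filterlim_at_left_to_right[of _ _ 0] minus_zero
    by (rule Lim_transform_eventually[OF lim[of "- (\<theta> / \<sigma>\<^sup>2)"]])
      (rule eventually_mono[OF eventually_at_right_less[of 0]], simp add: vg_formula_eq vg_half_def)
  ultimately show ?thesis by (simp add: filterlim_at_split)
qed

lemma vg_density_0:
  assumes "r > 1"
  shows "vg_density r \<theta> \<sigma> 0 = vg_const r \<theta> \<sigma> * bessel_kernel_0 ((r - 1) / 2)"
  using tendsto_Lim[OF _ vg_formula_tendsto[OF assms]] by (simp add: vg_density_def)

lemma vg_density_tendsto:
  assumes "r > 1"
  shows "(vg_density r \<theta> \<sigma> \<longlongrightarrow> vg_density r \<theta> \<sigma> 0) (at 0)"
  unfolding vg_density_0[OF assms]
  by (rule Lim_transform_eventually[OF vg_formula_tendsto[OF assms]])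
    (auto simp: eventually_at vg_density_def intro!: exI[of _ 1])

lemma vg_density_nonneg:
  assumes "r > 1"
  shows "vg_density r \<theta> \<sigma> x \<ge> 0"
proof (cases "x = 0")
  case True
  have "bessel_kernel_0 ((r - 1) / 2) > 0"
    using bessel_kernel_less_0[of "(r - 1) / 2" 1] bessel_kernel_pos[of 1 "(r - 1) / 2"] assms by simp
  then show ?thesis using True vg_const_pos by (simp add: vg_density_0[OF assms])
qed (use vg_density_nonzero_pos[of x] in simp)

lemma vg_density_Bfun:
  assumes "r > 1"
  shows "Bfun (vg_density r \<theta> \<sigma>) (at 0)"
proof (rule BfunI)
  show "\<forall>\<^sub>F x in at 0. norm (vg_density r \<theta> \<sigma> x) \<le> \<bar>vg_density r \<theta> \<sigma> 0\<bar> + 1"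
    using order_tendstoD(2)[OF tendsto_norm[OF vg_density_tendsto[OF assms]], of "\<bar>vg_density r \<theta> \<sigma> 0\<bar> + 1"]
    by (auto elim!: eventually_mono)
qed

text \<open>The order (r - 1) / 2 is not positive, so the kernel is unbounded at 0; on the right of
  0 the exponential factor is at least 1 and cannot compensate.\<close>

lemma vg_density_not_Bfun:
  assumes "r \<le> 1"
  shows "\<not> Bfun (vg_density r \<theta> \<sigma>) (at 0)"
proof
  assume "Bfun (vg_density r \<theta> \<sigma>) (at 0)"
  then obtain B where "\<forall>\<^sub>F x in at 0. norm (vg_density r \<theta> \<sigma> x) \<le> B" by (rule BfunE)
  then have 1: "\<forall>\<^sub>F x in at_right 0. norm (vg_density r \<theta> \<sigma> x) \<le> B"
    by (simp add: eventually_at_split)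
  define C where "C = B / vg_const r \<theta> \<sigma>"
  obtain d where d: "d > 0" "\<And>y. 0 < y \<Longrightarrow> y < d \<Longrightarrow> C < bessel_kernel ((r - 1) / 2) y"
    using bessel_kernel_unbounded[of "(r - 1) / 2" C] assms unfolding eventually_at_right_field by auto
  have "\<forall>\<^sub>F x in at_right 0. x \<in> {0<..<d / vg_rate \<theta> \<sigma>}"
    using d vg_rate_pos by (intro eventually_at_right_real) auto
  with 1 have "\<forall>\<^sub>F x in at_right (0::real). False"
  proof eventually_elim
    case (elim x)
    then have x: "x > 0" "vg_rate \<theta> \<sigma> * x < d" using vg_rate_pos by (auto simp: field_simps)
    have "C < bessel_kernel ((r - 1) / 2) (vg_rate \<theta> \<sigma> * x)" using x vg_rate_pos by (intro d(2)) auto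
    also have "\<dots> \<le> exp (\<theta> / \<sigma>\<^sup>2 * x) * bessel_kernel ((r - 1) / 2) (vg_rate \<theta> \<sigma> * x)"
      using x vg_rate_pos \<theta> bessel_kernel_pos[of "vg_rate \<theta> \<sigma> * x" "(r - 1) / 2"] by simp
    finally have "B < vg_const r \<theta> \<sigma> * vg_half ((r - 1) / 2) (vg_rate \<theta> \<sigma>) (\<theta> / \<sigma>\<^sup>2) x"
      using vg_const_pos by (simp add: C_def vg_half_def field_simps)
    then show False using elim by (simp add: vg_density_pos_eq[OF x(1)])
  qed
  then show False by simp
qed

section \<open>Locating the mode\<close>

lemma vg_mode_eqI:
  assumes "r > 1" and max: "\<And>x. x \<noteq> m \<Longrightarrow> vg_density r \<theta> \<sigma> x < vg_density r \<theta> \<sigma> m"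
  shows "vg_mode r \<theta> \<sigma> = m"
proof -
  have "(THE m. \<forall>x. vg_density r \<theta> \<sigma> x \<le> vg_density r \<theta> \<sigma> m) = m"
  proof (rule the_equality)
    show "\<forall>x. vg_density r \<theta> \<sigma> x \<le> vg_density r \<theta> \<sigma> m" using max less_imp_le by (metis order_refl)
    show "m' = m" if "\<forall>x. vg_density r \<theta> \<sigma> x \<le> vg_density r \<theta> \<sigma> m'" for m'
      using max[of m'] that by (metis not_less)
  qed
  then show ?thesis using vg_density_Bfun[OF assms(1)] by (simp add: vg_mode_def)
qed

text \<open>For r \<le> 1 the density is unbounded. For 1 < r \<le> 2 the order is at most 1/2, so
  the ratio is at least 1 and exceeds \<kappa> everywhere, and the density decreases on the positive
  half-line.\<close>

lemma vg_mode_eq_0: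
  assumes "r \<le> 2"
  shows "vg_mode r \<theta> \<sigma> = 0"
proof (cases "r \<le> 1")
  case True
  then show ?thesis using vg_density_not_Bfun by (simp add: vg_mode_def)
next
  case False
  then have r1: "r > 1" by simp
  let ?p = "vg_density r \<theta> \<sigma>"
  have decr: "?p y < ?p x" if "0 < x" "x < y" for x y
  proof (rule DERIV_neg_imp_decreasing[OF that(2)])
    fix t assume "x \<le> t"
    then have t: "t > 0" using that by simp
    have "bessel_ratio ((r - 1) / 2) (vg_rate \<theta> \<sigma> * t) \<ge> 1"
      using r1 assms t vg_rate_pos by (intro bessel_ratio_ge_1) auto
    then have "vg_rate \<theta> \<sigma> * ?p t * (vg_ratio \<theta> \<sigma> - bessel_ratio ((r - 1) / 2) (vg_rate \<theta> \<sigma> * t)) < 0"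
      using t vg_ratio_bounds by (intro mult_pos_neg mult_pos_pos vg_rate_pos vg_density_nonzero_pos) auto
    then show "\<exists>D. DERIV ?p t :> D \<and> D < 0" using vg_density_DERIV[OF t] by blast
  qed
  have pos: "?p x < ?p 0" if "x > 0" for x
  proof -
    have "?p x < ?p (x / 2)" using that by (intro decr) auto
    also have "\<dots> \<le> ?p 0"
    proof (rule tendsto_lowerbound)
      show "(?p \<longlongrightarrow> ?p 0) (at_right 0)" using vg_density_tendsto[OF r1] by (simp add: filterlim_at_split)
      have "\<forall>\<^sub>F y in at_right 0. y \<in> {0<..<x / 2}" using that by (intro eventually_at_right_real) auto
      then show "\<forall>\<^sub>F y in at_right 0. ?p (x / 2) \<le> ?p y"
        by eventually_elim (auto intro!: less_imp_le decr)
    qed simp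
    finally show ?thesis .
  qed
  show ?thesis
  proof (rule vg_mode_eqI[OF r1])
    fix x :: real assume "x \<noteq> 0"
    then consider "x > 0" | "- x > 0" by linarith
    then show "?p x < ?p 0"
    proof cases
      case 2
      then show ?thesis using vg_density_reflect[of "- x"] pos[of "- x"] by simp
    qed (rule pos)
  qed
qed

text \<open>The derivative of the density at t > 0 has the sign of \<kappa> - R(c t). Since R
  increases strictly, it changes sign once, at \<open>m = y / c\<close> with R(y) = \<kappa>, and
  from plus to minus.\<close>

lemma vg_mode_root:
  assumes r2: "r > 2"
  shows "vg_mode r \<theta> \<sigma> > 0"
    and "bessel_ratio ((r - 1) / 2) (vg_rate \<theta> \<sigma> * vg_mode r \<theta> \<sigma>) = vg_ratio \<theta> \<sigma>"
proof -
  define \<nu> where "\<nu> = (r - 1) / 2"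
  have \<nu>: "\<nu> > 1/2" using r2 by (simp add: \<nu>_def)
  have r1: "r > 1" using r2 by simp
  let ?p = "vg_density r \<theta> \<sigma>"
  let ?c = "vg_rate \<theta> \<sigma>"
  note c = vg_rate_pos
  obtain y where y: "y > 0" "bessel_ratio \<nu> y = vg_ratio \<theta> \<sigma>"
    using bessel_ratio_root_exists[OF \<nu> vg_ratio_bounds] by blast
  define m where "m = y / ?c"
  have m: "m > 0" "?c * m = y" using y c by (auto simp: m_def)
  have less: "bessel_ratio \<nu> (?c * t) < vg_ratio \<theta> \<sigma>" if "0 < t" "t < m" for t
    using bessel_ratio_strict_mono[OF \<nu>, of "?c * t" y] that c y by (simp add: m_def field_simps)
  have greater: "bessel_ratio \<nu> (?c * t) > vg_ratio \<theta> \<sigma>" if "m < t" for t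
    using bessel_ratio_strict_mono[OF \<nu> y(1), of "?c * t"] that c y by (simp add: m_def field_simps)
  have cont: "isCont ?p t" if "t > 0" for t using vg_density_DERIV[OF that] by (rule DERIV_isCont)
  have incr: "?p u < ?p v" if "0 < u" "u < v" "v \<le> m" for u v
  proof (rule DERIV_pos_imp_increasing_open[OF that(2)])
    fix t assume t: "u < t" "t < v"
    then have "0 < ?c * ?p t * (vg_ratio \<theta> \<sigma> - bessel_ratio \<nu> (?c * t))"
      using that less[of t] by (intro mult_pos_pos vg_rate_pos vg_density_nonzero_pos) auto
    then show "\<exists>D. DERIV ?p t :> D \<and> D > 0" unfolding \<nu>_def using vg_density_DERIV[of t] that t by auto
  next
    show "continuous_on {u..v} ?p" using that cont by (intro continuous_at_imp_continuous_on) auto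
  qed
  have decr: "?p v < ?p m" if "m < v" for v
  proof (rule DERIV_neg_imp_decreasing_open[OF that])
    fix t assume t: "m < t" "t < v"
    then have "?c * ?p t * (vg_ratio \<theta> \<sigma> - bessel_ratio \<nu> (?c * t)) < 0"
      using m greater[of t] by (intro mult_pos_neg mult_pos_pos vg_rate_pos vg_density_nonzero_pos) auto
    then show "\<exists>D. DERIV ?p t :> D \<and> D < 0" unfolding \<nu>_def using vg_density_DERIV[of t] m t by auto
  next
    show "continuous_on {m..v} ?p" using m cont by (intro continuous_at_imp_continuous_on) auto
  qed
  \<comment> \<open>The derivative formula covers only positive points. The value at 0 is a limit of
    values that stay below \<open>?p (m / 2)\<close>, and the step from \<open>m / 2\<close> to
    \<open>m\<close> makes the comparison strict.\<close>
  have zero: "?p 0 < ?p m"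
  proof -
    have "?p 0 \<le> ?p (m / 2)"
    proof (rule tendsto_upperbound)
      show "(?p \<longlongrightarrow> ?p 0) (at_right 0)" using vg_density_tendsto[OF r1] by (simp add: filterlim_at_split)
      have "\<forall>\<^sub>F y in at_right 0. y \<in> {0<..<m / 2}" using m by (intro eventually_at_right_real) auto
      then show "\<forall>\<^sub>F y in at_right 0. ?p y \<le> ?p (m / 2)"
        by eventually_elim (use m in \<open>auto intro!: less_imp_le incr\<close>)
    qed simp
    also have "\<dots> < ?p m" using m by (intro incr) auto
    finally show ?thesis .
  qed
  have pos: "?p x \<le> ?p m" if "x > 0" for x
    using incr[of x m] decr[of x] that by (cases x m rule: linorder_cases) auto
  have "vg_mode r \<theta> \<sigma> = m"
  proof (rule vg_mode_eqI[OF r1])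
    fix x assume x: "x \<noteq> m"
    consider "x > 0" | "x = 0" | "- x > 0" by linarith
    then show "?p x < ?p m"
    proof cases
      case 1
      then show ?thesis using incr[of x m] decr[of x] x by (cases x m rule: linorder_cases) auto
    next
      case 3
      then show ?thesis using vg_density_reflect[of "- x"] pos[of "- x"] by simp
    qed (use zero in simp)
  qed
  then show "vg_mode r \<theta> \<sigma> > 0" "bessel_ratio ((r - 1) / 2) (?c * vg_mode r \<theta> \<sigma>) = vg_ratio \<theta> \<sigma>"
    using m y by (auto simp: \<nu>_def)
qed

lemma vg_mode_bounds:
  assumes r2: "r > 2"
  shows "vg_mode r \<theta> \<sigma> < \<theta> * (r - 2)"
    and "\<theta> * (r - 3) < vg_mode r \<theta> \<sigma>"
    and "r > 4 \<Longrightarrow> vg_mode_bound r \<theta> \<sigma> < vg_mode r \<theta> \<sigma>"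
    and "r = 4 \<Longrightarrow> vg_mode r \<theta> \<sigma> = vg_mode_bound r \<theta> \<sigma>"
    and "r < 4 \<Longrightarrow> vg_mode r \<theta> \<sigma> < vg_mode_bound r \<theta> \<sigma>"
proof -
  define \<nu> where "\<nu> = (r - 1) / 2"
  let ?c = "vg_rate \<theta> \<sigma>" and ?\<kappa> = "vg_ratio \<theta> \<sigma>" and ?M = "vg_mode r \<theta> \<sigma>"
  have \<nu>: "\<nu> > 1/2" using r2 by (simp add: \<nu>_def)
  note root = vg_mode_root[OF r2, folded \<nu>_def]
  have y: "?c * ?M > 0" using root vg_rate_pos by simp
  note bounds = bessel_ratio_root_bounds[OF \<nu> vg_ratio_bounds y root(2)]
  have scale: "?\<kappa> * t / (1 - ?\<kappa>\<^sup>2) = ?c * (\<theta> * t)" for t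
  proof -
    have "?\<kappa> * t / (1 - ?\<kappa>\<^sup>2) = ?\<kappa> / (1 - ?\<kappa>\<^sup>2) * t" by simp
    then show ?thesis unfolding vg_ratio_scaling by simp
  qed
  have "2 * (\<nu> - 1/2) = r - 2" by (simp add: \<nu>_def diff_divide_distrib right_diff_distrib)
  then have "2 * (\<nu> - 1/2) * ?\<kappa> / (1 - ?\<kappa>\<^sup>2) = ?c * (\<theta> * (r - 2))"
    using scale[of "r - 2"] by (simp only: mult.commute[of _ ?\<kappa>])
  then show "?M < \<theta> * (r - 2)" using bounds(1) vg_rate_pos by simp
  show "\<theta> * (r - 3) < ?M"
  \<comment> \<open>The upper Amos bound needs \<nu> > 1, that is r > 3; for r \<le> 3 the claimed
    lower bound is not positive while the mode is.\<close>
  proof (cases "r > 3")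
    case True
    have "2 * (\<nu> - 1) = r - 3" by (simp add: \<nu>_def diff_divide_distrib right_diff_distrib)
    then have "2 * (\<nu> - 1) * ?\<kappa> / (1 - ?\<kappa>\<^sup>2) = ?c * (\<theta> * (r - 3))"
      using scale[of "r - 3"] by (simp only: mult.commute[of _ ?\<kappa>])
    then show ?thesis using bounds(2) vg_rate_pos True by (simp add: \<nu>_def)
  next
    case False
    then have "\<theta> * (r - 3) \<le> 0" using \<theta> by (simp add: mult_le_0_iff)
    then show ?thesis using root(1) by simp
  qed
  have p: "\<theta>\<^sup>2 + \<sigma>\<^sup>2 > 0" using \<theta> by (simp add: add_pos_nonneg)
  have "?\<kappa>\<^sup>2 * (\<nu> - 1/2)\<^sup>2 + (1 - ?\<kappa>\<^sup>2) * (\<nu> - 3/2)\<^sup>2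
      = (\<theta>\<^sup>2 * (r - 2)\<^sup>2 + \<sigma>\<^sup>2 * (r - 4)\<^sup>2) / (\<theta>\<^sup>2 + \<sigma>\<^sup>2) / 2\<^sup>2"
  proof -
    have \<kappa>: "?\<kappa>\<^sup>2 = \<theta>\<^sup>2 / (\<theta>\<^sup>2 + \<sigma>\<^sup>2)" using p by (simp add: vg_ratio_def power_divide)
    have half: "\<nu> - 1/2 = (r - 2) / 2" "\<nu> - 3/2 = (r - 4) / 2" by (auto simp: \<nu>_def field_simps)
    show ?thesis unfolding vg_ratio_sq unfolding \<kappa> half power_divide by (simp add: add_divide_distrib)
  qed
  then have "sqrt (?\<kappa>\<^sup>2 * (\<nu> - 1/2)\<^sup>2 + (1 - ?\<kappa>\<^sup>2) * (\<nu> - 3/2)\<^sup>2)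
      = sqrt ((\<theta>\<^sup>2 * (r - 2)\<^sup>2 + \<sigma>\<^sup>2 * (r - 4)\<^sup>2) / (\<theta>\<^sup>2 + \<sigma>\<^sup>2)) / 2"
    by (simp only: real_sqrt_divide real_sqrt_power) simp
  then have z: "?\<kappa> * (\<nu> - 1/2 + sqrt (?\<kappa>\<^sup>2 * (\<nu> - 1/2)\<^sup>2 + (1 - ?\<kappa>\<^sup>2) * (\<nu> - 3/2)\<^sup>2)) / (1 - ?\<kappa>\<^sup>2)
      = ?c * vg_mode_bound r \<theta> \<sigma>"
    unfolding scale vg_mode_bound_def \<nu>_def by (simp add: field_simps)
  note zb = bounds(3-5)[unfolded z]
  show "r > 4 \<Longrightarrow> vg_mode_bound r \<theta> \<sigma> < ?M" using zb(1) vg_rate_pos by (simp add: \<nu>_def)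
  show "r = 4 \<Longrightarrow> ?M = vg_mode_bound r \<theta> \<sigma>" using zb(2) vg_rate_pos by (simp add: \<nu>_def)
  show "r < 4 \<Longrightarrow> ?M < vg_mode_bound r \<theta> \<sigma>" using zb(3) vg_rate_pos by (simp add: \<nu>_def)
qed

end

text \<open>The radicand is the mean of (r - 2)^2 and (r - 4)^2 with weights proportional to
  \<theta>^2 and \<sigma>^2, so it lies strictly between them when they differ. Their order switches
  at r = 3.\<close>

lemma vg_mode_bound_compare:
  shows "r > 4 \<Longrightarrow> \<theta> * (r - 3) < vg_mode_bound r \<theta> \<sigma>"
    and "3 < r \<Longrightarrow> r < 4 \<Longrightarrow> vg_mode_bound r \<theta> \<sigma> < \<theta> * (r - 2)"
    and "2 < r \<Longrightarrow> r < 3 \<Longrightarrow> \<theta> * (r - 2) < vg_mode_bound r \<theta> \<sigma>"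
proof -
  define q where "q = sqrt ((\<theta>\<^sup>2 * (r - 2)\<^sup>2 + \<sigma>\<^sup>2 * (r - 4)\<^sup>2) / (\<theta>\<^sup>2 + \<sigma>\<^sup>2))"
  have p: "\<theta>\<^sup>2 + \<sigma>\<^sup>2 > 0" using \<theta> by (simp add: add_pos_nonneg)
  have bound: "vg_mode_bound r \<theta> \<sigma> = \<theta> * ((r - 2 + q) / 2)" by (simp add: vg_mode_bound_def q_def)
  have low: "\<bar>r - 4\<bar> < q" if "(r - 4)\<^sup>2 < (r - 2)\<^sup>2"
  proof -
    have "(r - 4)\<^sup>2 * (\<theta>\<^sup>2 + \<sigma>\<^sup>2) < \<theta>\<^sup>2 * (r - 2)\<^sup>2 + \<sigma>\<^sup>2 * (r - 4)\<^sup>2"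
      using mult_strict_left_mono[OF that, of "\<theta>\<^sup>2"] \<theta> by (simp add: algebra_simps)
    then have "(r - 4)\<^sup>2 < (\<theta>\<^sup>2 * (r - 2)\<^sup>2 + \<sigma>\<^sup>2 * (r - 4)\<^sup>2) / (\<theta>\<^sup>2 + \<sigma>\<^sup>2)"
      using p by (simp add: pos_less_divide_eq)
    then show ?thesis unfolding q_def by (intro real_less_rsqrt) simp
  qed
  have upp: "q < \<bar>r - 2\<bar>" if "(r - 4)\<^sup>2 < (r - 2)\<^sup>2"
  proof -
    have "\<theta>\<^sup>2 * (r - 2)\<^sup>2 + \<sigma>\<^sup>2 * (r - 4)\<^sup>2 < (r - 2)\<^sup>2 * (\<theta>\<^sup>2 + \<sigma>\<^sup>2)"
      using mult_strict_left_mono[OF that, of "\<sigma>\<^sup>2"] \<sigma> by (simp add: algebra_simps)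
    then have "(\<theta>\<^sup>2 * (r - 2)\<^sup>2 + \<sigma>\<^sup>2 * (r - 4)\<^sup>2) / (\<theta>\<^sup>2 + \<sigma>\<^sup>2) < (r - 2)\<^sup>2"
      using p by (simp add: pos_divide_less_eq)
    then have "q < sqrt ((r - 2)\<^sup>2)" unfolding q_def by (rule real_sqrt_less_mono)
    then show ?thesis by simp
  qed
  have low': "r - 2 < q" if "2 < r" "r < 3"
  proof -
    have "(r - 2)\<^sup>2 < (r - 4)\<^sup>2" using that by (simp add: power2_eq_square algebra_simps)
    then have "(r - 2)\<^sup>2 * (\<theta>\<^sup>2 + \<sigma>\<^sup>2) < \<theta>\<^sup>2 * (r - 2)\<^sup>2 + \<sigma>\<^sup>2 * (r - 4)\<^sup>2"
      using mult_strict_left_mono[of _ _ "\<sigma>\<^sup>2"] \<sigma> by (simp add: algebra_simps)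
    then have "(r - 2)\<^sup>2 < (\<theta>\<^sup>2 * (r - 2)\<^sup>2 + \<sigma>\<^sup>2 * (r - 4)\<^sup>2) / (\<theta>\<^sup>2 + \<sigma>\<^sup>2)"
      using p by (simp add: pos_less_divide_eq)
    then show ?thesis unfolding q_def by (intro real_less_rsqrt)
  qed
  have sq: "(r - 4)\<^sup>2 < (r - 2)\<^sup>2" if "r > 3" using that by (simp add: power2_eq_square algebra_simps)
  show "\<theta> * (r - 3) < vg_mode_bound r \<theta> \<sigma>" if "r > 4"
    unfolding bound using low sq that \<theta> by (intro mult_strict_left_mono) auto
  show "vg_mode_bound r \<theta> \<sigma> < \<theta> * (r - 2)" if "3 < r" "r < 4"
    unfolding bound using upp sq that \<theta> by (intro mult_strict_left_mono) auto
  show "\<theta> * (r - 2) < vg_mode_bound r \<theta> \<sigma>" if "2 < r" "r < 3"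
    unfolding bound using low' that \<theta> by (intro mult_strict_left_mono) auto
qed

text \<open>At r = 4 equality holds in (C) and the \<sigma>-term under the root vanishes. This
  explicit mode drives all the optimality claims.\<close>

lemma vg_mode_4: "vg_mode 4 \<theta> \<sigma> = \<theta> * (1 + vg_ratio \<theta> \<sigma>)"
proof -
  have "sqrt (\<theta>\<^sup>2 * 2\<^sup>2 / (\<theta>\<^sup>2 + \<sigma>\<^sup>2)) = 2 * vg_ratio \<theta> \<sigma>"
    using \<theta> by (simp add: vg_ratio_def real_sqrt_divide real_sqrt_mult)
  then show ?thesis using vg_mode_bounds(4)[of 4] by (simp add: vg_mode_bound_def algebra_simps)
qed

end

section \<open>The mean, and the case of parameter 4\<close>

text \<open>Substitute u = sqrt(2x) sinh(t / 2) in the Gaussian integral: cosh t = 1 + 2 sinh(t /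
  2)^2 turns x cosh t into x + u^2, and du supplies the factor cosh(t / 2).\<close>

lemma bessel_K_half:
  assumes x: "x > 0"
  shows "bessel_K (1/2) x = sqrt (pi / (2 * x)) * exp (- x)"
proof -
  let ?w = "sqrt (2 * x)"
  let ?g = "\<lambda>t. ?w * sinh (t / 2)" and ?g' = "\<lambda>t. ?w * (cosh (t / 2) / 2)"
  let ?f = "\<lambda>u::real. exp (- u\<^sup>2)"
  have w: "?w > 0" using x by simp
  have eq: "?f (?g t) * ?g' t = ?w / 2 * exp x * bessel_integrand (1/2) x t" for t
  proof -
    have "cosh t = 1 + 2 * (sinh (t / 2))\<^sup>2"
      using cosh_double[of "t / 2"] cosh_square_eq[of "t / 2"] by simp
    then have "- (?g t)\<^sup>2 = x + - (x * cosh t)" using x by (simp add: power_mult_distrib algebra_simps)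
    then have "?f (?g t) = exp x * exp (- (x * cosh t))" by (simp only: exp_add)
    then show ?thesis by simp
  qed
  have sub: "(LBINT u=ereal 0..\<infinity>. ?f u) = (LBINT t=ereal 0..\<infinity>. ?f (?g t) * ?g' t)"
  proof (rule interval_integral_substitution_nonneg(2))
    show "DERIV ?g t :> ?g' t" for t by (auto intro!: derivative_eq_intros)
    show "isCont ?g' t" for t by (intro continuous_intros) auto
    show "isCont ?f (?g t)" for t by (intro continuous_intros)
    have "(?g \<longlongrightarrow> ?g 0) (at_right 0)" by (intro tendsto_intros) auto
    then show "((ereal \<circ> ?g \<circ> real_of_ereal) \<longlongrightarrow> ereal 0) (at_right (ereal 0))"
      by (simp add: ereal_tendsto_simps)
    have "filterlim ?g at_top at_top"
      using w by real_asymp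
    then show "((ereal \<circ> ?g \<circ> real_of_ereal) \<longlongrightarrow> \<infinity>) (at_left \<infinity>)"
      by (simp add: ereal_tendsto_simps)
    show "set_integrable lborel (einterval (ereal 0) \<infinity>) (\<lambda>t. ?f (?g t) * ?g' t)"
      unfolding eq by (intro set_integrable_mult_right set_integrable_subset[OF bessel_integrable[OF x]]) auto
  qed (use w in auto)
  have "(LBINT u=ereal 0..\<infinity>. ?f u) = (LBINT u:{0..}. ?f u)"
    unfolding interval_integral_to_infinity_eq by (rule set_integral_discrete_difference[where X="{0}"]) auto
  also have "\<dots> = sqrt pi / 2"
    using gaussian_moment_0 by (simp add: has_bochner_integral_iff set_lebesgue_integral_def)
  finally have 1: "(LBINT u=ereal 0..\<infinity>. ?f u) = sqrt pi / 2" .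
  have "(LBINT t=ereal 0..\<infinity>. ?f (?g t) * ?g' t) = (LBINT t:{0..}. ?f (?g t) * ?g' t)"
    unfolding interval_integral_to_infinity_eq by (rule set_integral_discrete_difference[where X="{0}"]) auto
  also have "\<dots> = ?w / 2 * exp x * bessel_K (1/2) x"
    unfolding eq bessel_K_altdef by (rule set_integral_mult_right)
  finally have "?w / 2 * exp x * bessel_K (1/2) x = sqrt pi / 2" using sub 1 by simp
  then have "bessel_K (1/2) x = sqrt pi / ?w / exp x" using w by (simp add: field_simps)
  also have "sqrt pi / ?w = sqrt (pi / (2 * x))" by (rule real_sqrt_divide[symmetric])
  finally show ?thesis by (simp add: exp_minus field_simps)
qed

text \<open>The equality case \<nu> = 3/2 of \<open>bessel_ratio_sharp\<close> expresses order 3/2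
  through order 1/2.\<close>

lemma bessel_kernel_three_halves:
  assumes x: "x > 0"
  shows "bessel_kernel (3/2) x = sqrt (pi / 2) * (1 + x) * exp (- x)"
proof -
  have "bessel_ratio (3/2) x = x / (1 + x)"
    using bessel_ratio_sharp(2)[of "3/2" x] x by (simp add: amos_def)
  then have K: "bessel_K (3/2) x = (1 + x) / x * bessel_K (1/2) x"
    using x bessel_K_pos[OF x, of "3/2"] by (simp add: bessel_ratio_def field_simps)
  have "x powr (3/2) = x powr (1 + 1/2)" by simp
  also have "\<dots> = x * sqrt x" using x by (subst powr_add) (simp add: powr_half_sqrt)
  finally have "bessel_kernel (3/2) x = (1 + x) * (sqrt x * bessel_K (1/2) x)"
    using x by (simp add: bessel_kernel_def K)
  also have "sqrt x * bessel_K (1/2) x = sqrt (pi / 2) * exp (- x)"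
    using x by (simp add: bessel_K_half real_sqrt_divide real_sqrt_mult)
  finally show ?thesis by simp
qed

lemma vg_half_three_halves_integral:
  assumes c: "c > 0" "\<beta> < c"
  shows "(LBINT x:{0<..}. vg_half (3/2) c \<beta> x) = sqrt (pi / 2) * (1 / (c - \<beta>) + c / (c - \<beta>)\<^sup>2)"
proof -
  define d where "d = c - \<beta>"
  have d: "d > 0" using c by (simp add: d_def)
  let ?f = "\<lambda>x. (1 + c * x) * exp (- d * x)"
  let ?F = "\<lambda>x. - (((1 + c * x) / d + c / d\<^sup>2) * exp (- d * x))"
  have "(LBINT x=ereal 0..\<infinity>. ?f x) = 0 - (- (1 / d + c / d\<^sup>2))"
  proof (rule interval_integral_FTC_nonneg(2))
    show "DERIV ?F x :> ?f x" for x
    proof -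
      have "DERIV ?F x :> - ((c / d) * exp (- d * x) + ((1 + c * x) / d + c / d\<^sup>2) * (exp (- d * x) * - d))"
        using d by (auto intro!: derivative_eq_intros)
      then show ?thesis by (rule DERIV_cong) (use d in \<open>simp add: field_simps power2_eq_square\<close>)
    qed
    show "isCont ?f x" for x by (intro continuous_intros)
    show "AE x in lborel. ereal 0 < ereal x \<longrightarrow> ereal x < \<infinity> \<longrightarrow> 0 \<le> ?f x" using c by auto
    have "(?F \<longlongrightarrow> ?F 0) (at_right 0)" using d by (intro tendsto_intros) auto
    then show "((?F \<circ> real_of_ereal) \<longlongrightarrow> - (1 / d + c / d\<^sup>2)) (at_right (ereal 0))"
      by (simp add: ereal_tendsto_simps1)
    have "(?F \<longlongrightarrow> 0) at_top" using d c(1) by real_asymp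
    then show "((?F \<circ> real_of_ereal) \<longlongrightarrow> 0) (at_left \<infinity>)" by (simp only: ereal_tendsto_simps1)
  qed auto
  then have "(LBINT x:{0<..}. ?f x) = 1 / d + c / d\<^sup>2"
    unfolding interval_integral_to_infinity_eq by simp
  moreover have "(LBINT x:{0<..}. vg_half (3/2) c \<beta> x) = (LBINT x:{0<..}. sqrt (pi / 2) * ?f x)"
  proof (rule set_lebesgue_integral_cong)
    show "\<forall>x. x \<in> {0<..} \<longrightarrow> vg_half (3/2) c \<beta> x = sqrt (pi / 2) * ?f x"
    proof (intro allI impI)
      fix x :: real assume "x \<in> {0<..}"
      then have "c * x > 0" using c by simp
      then have "vg_half (3/2) c \<beta> x = sqrt (pi / 2) * (1 + c * x) * (exp (\<beta> * x) * exp (- (c * x)))"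
        by (simp add: vg_half_def bessel_kernel_three_halves)
      also have "exp (\<beta> * x) * exp (- (c * x)) = exp (- d * x)"
        unfolding exp_add[symmetric] by (simp add: d_def algebra_simps)
      finally show "vg_half (3/2) c \<beta> x = sqrt (pi / 2) * ?f x" by simp
    qed
  qed simp
  ultimately show ?thesis unfolding d_def[symmetric] by simp
qed

context
  fixes \<theta> \<sigma> :: real
  assumes \<theta>: "\<theta> > 0" and \<sigma>: "\<sigma> > 0"
begin

lemma vg_density_integrals:
  assumes r: "r > 1"
  defines "h \<equiv> vg_half ((r - 1) / 2) (vg_rate \<theta> \<sigma>)" and "\<beta> \<equiv> \<theta> / \<sigma>\<^sup>2"
  shows "integrable lborel (vg_density r \<theta> \<sigma>)"
    and "(\<integral>x. vg_density r \<theta> \<sigma> x \<partial>lborel) = vg_const r \<theta> \<sigma> * ((LBINT x:{0<..}. h \<beta> x) + (LBINT x:{0<..}. h (- \<beta>) x))"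
    and "(\<integral>x. vg_density r \<theta> \<sigma> x * x \<partial>lborel)
      = vg_const r \<theta> \<sigma> * ((LBINT x:{0<..}. x * h \<beta> x) - (LBINT x:{0<..}. x * h (- \<beta>) x))"
proof -
  let ?p = "vg_density r \<theta> \<sigma>" and ?N = "vg_const r \<theta> \<sigma>"
  have r0: "r > 0" using r by simp
  have \<nu>: "(r - 1) / 2 > 0" using r by simp
  note c = vg_rate_pos[OF \<theta> \<sigma>]
  have b: "\<beta> < vg_rate \<theta> \<sigma>" "- \<beta> < vg_rate \<theta> \<sigma>"
    using vg_tilt_less[OF \<theta> \<sigma>] divide_pos_pos[OF \<theta>, of "\<sigma>\<^sup>2"] \<sigma> unfolding \<beta>_def by auto
  note int = vg_half_integrable[OF \<nu> c b(1), folded h_def] vg_half_integrable[OF \<nu> c b(2), folded h_def]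
  have pos: "?p x = ?N * h \<beta> x" and neg: "?p (- x) = ?N * h (- \<beta>) x" if "x > 0" for x
    using vg_density_pos_eq[OF \<theta> \<sigma> r0 that] vg_density_neg_eq[OF \<theta> \<sigma> r0 that] by (auto simp: h_def \<beta>_def)
  have i1: "set_integrable lborel {0<..} ?p"
    using set_integrable_mult_right[OF int(1), of ?N]
    by (rule set_integrable_cong[THEN iffD1, rotated 3]) (auto simp: pos)
  have i2: "set_integrable lborel {0<..} (\<lambda>x. ?p (- x))"
    using set_integrable_mult_right[OF int(3), of ?N]
    by (rule set_integrable_cong[THEN iffD1, rotated 3]) (auto simp: neg)
  have i3: "set_integrable lborel {0<..} (\<lambda>x. ?p x * x)"
    using set_integrable_mult_right[OF int(2), of ?N]
    by (rule set_integrable_cong[THEN iffD1, rotated 3]) (auto simp: pos)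
  have i4: "set_integrable lborel {0<..} (\<lambda>x. ?p (- x) * - x)"
    using set_integrable_mult_right[OF int(4), of "- ?N"]
    by (rule set_integrable_cong[THEN iffD1, rotated 3]) (auto simp: neg)
  show "integrable lborel ?p" using integral_split_reflect(1)[OF i1 i2] .
  have "(LBINT x:{0<..}. ?p x) = (LBINT x:{0<..}. ?N * h \<beta> x)"
    by (rule set_lebesgue_integral_cong) (auto simp: pos)
  moreover have "(LBINT x:{0<..}. ?p (- x)) = (LBINT x:{0<..}. ?N * h (- \<beta>) x)"
    by (rule set_lebesgue_integral_cong) (auto simp: neg)
  ultimately show "(\<integral>x. ?p x \<partial>lborel) = ?N * ((LBINT x:{0<..}. h \<beta> x) + (LBINT x:{0<..}. h (- \<beta>) x))"
    using integral_split_reflect(2)[OF i1 i2] by (simp add: distrib_left)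
  have m3: "(LBINT x:{0<..}. ?p x * x) = ?N * (LBINT x:{0<..}. x * h \<beta> x)"
    unfolding set_integral_mult_right[symmetric] by (rule set_lebesgue_integral_cong) (auto simp: pos)
  have m4: "(LBINT x:{0<..}. ?p (- x) * - x) = - ?N * (LBINT x:{0<..}. x * h (- \<beta>) x)"
    unfolding set_integral_mult_right[symmetric] by (rule set_lebesgue_integral_cong) (auto simp: neg)
  show "(\<integral>x. ?p x * x \<partial>lborel) = ?N * ((LBINT x:{0<..}. x * h \<beta> x) - (LBINT x:{0<..}. x * h (- \<beta>) x))"
    unfolding integral_split_reflect(2)[OF i3 i4] m3 m4 by (simp add: right_diff_distrib)
qed

text \<open>Subtracting the moment identities of the two half-lines cancels the boundary terms and
  leaves r \<beta> times the total mass. That the mass is 1 follows from the existence of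
  \<open>X\<close> with this density, so the normalising constant is not evaluated here.\<close>

lemma vg_expectation:
  fixes P :: "'a measure"
  assumes r: "r > 2" and X: "vg_distributed P X r \<theta> \<sigma>"
  shows "prob_space.expectation P X = r * \<theta>"
proof -
  interpret prob_space P using X by (simp add: vg_distributed_def)
  have r1: "r > 1" "r > 0" and \<nu>: "(r - 1) / 2 > 1/2" using r by auto
  have D: "distributed P lborel X (\<lambda>x. ennreal (vg_density r \<theta> \<sigma> x))" using X by (simp add: vg_distributed_def)
  note nonneg = vg_density_nonneg[OF \<theta> \<sigma> r1(2,1)]
  define \<beta> where "\<beta> = \<theta> / \<sigma>\<^sup>2"
  let ?c = "vg_rate \<theta> \<sigma>" and ?N = "vg_const r \<theta> \<sigma>"
  let ?h = "vg_half ((r - 1) / 2) ?c"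
  let ?A = "LBINT x:{0<..}. ?h \<beta> x" and ?B = "LBINT x:{0<..}. ?h (- \<beta>) x"
  let ?A1 = "LBINT x:{0<..}. x * ?h \<beta> x" and ?B1 = "LBINT x:{0<..}. x * ?h (- \<beta>) x"
  have b: "\<beta> < ?c" "- \<beta> < ?c"
    using vg_tilt_less[OF \<theta> \<sigma>] divide_pos_pos[OF \<theta>, of "\<sigma>\<^sup>2"] \<sigma> vg_rate_pos[OF \<theta> \<sigma>] unfolding \<beta>_def by auto
  have "(\<integral>x. vg_density r \<theta> \<sigma> x * 1 \<partial>lborel) = expectation (\<lambda>_. 1)"
    by (rule distributed_integral[OF D]) (use nonneg in auto)
  then have mass: "?N * (?A + ?B) = 1"
    using vg_density_integrals(2)[OF r1(1)] by (simp add: prob_space \<beta>_def)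
  have "(\<integral>x. vg_density r \<theta> \<sigma> x * x \<partial>lborel) = expectation X"
    by (rule distributed_integral[OF D]) (use nonneg in auto)
  then have E: "expectation X = ?N * (?A1 - ?B1)"
    using vg_density_integrals(3)[OF r1(1)] by (simp add: \<beta>_def)
  have "(?c\<^sup>2 - \<beta>\<^sup>2) * (?A1 - ?B1) = r * \<beta> * (?A + ?B)"
  proof -
    have r': "2 * ((r - 1) / 2) + 1 = r" by (simp add: diff_divide_distrib right_diff_distrib)
    define K where "K = 2 * ((r - 1) / 2) * bessel_kernel_0 ((r - 1) / 2)"
    have 1: "(?c\<^sup>2 - \<beta>\<^sup>2) * ?A1 = r * \<beta> * ?A + K"
      using vg_half_moment[OF \<nu> vg_rate_pos[OF \<theta> \<sigma>] b(1)] unfolding r' K_def .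
    have 2: "(?c\<^sup>2 - \<beta>\<^sup>2) * ?B1 = r * - \<beta> * ?B + K"
      using vg_half_moment[OF \<nu> vg_rate_pos[OF \<theta> \<sigma>] b(2)] unfolding r' K_def power2_minus .
    show ?thesis unfolding right_diff_distrib[of "?c\<^sup>2 - \<beta>\<^sup>2"] distrib_left[of "r * \<beta>"] 1 2 by simp
  qed
  then have "1 / \<sigma>\<^sup>2 * (?A1 - ?B1) = r * \<theta> / \<sigma>\<^sup>2 * (?A + ?B)"
    using vg_rate_sq_diff[OF \<theta> \<sigma>] by (simp add: \<beta>_def)
  then have "?A1 - ?B1 = r * \<theta> * (?A + ?B)" using \<sigma> by (simp add: field_simps)
  then have "expectation X = r * \<theta> * (?N * (?A + ?B))" unfolding E by simp
  then show ?thesis unfolding mass by simp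
qed

text \<open>The optimality claims for (B) quantify over random variables with the given law, so
  refuting a bound requires one to exist. For r = 4 the kernel is elementary and the mass can be
  computed directly.\<close>

lemma vg_density_4_mass: "(\<integral>x. vg_density 4 \<theta> \<sigma> x \<partial>lborel) = 1"
proof -
  define S where "S = sqrt (\<theta>\<^sup>2 + \<sigma>\<^sup>2)"
  have S: "S > 0" "\<theta>\<^sup>2 + \<sigma>\<^sup>2 = S\<^sup>2" using \<theta> by (auto simp: S_def add_pos_nonneg)
  define c where "c = vg_rate \<theta> \<sigma>"
  define \<beta> where "\<beta> = \<theta> / \<sigma>\<^sup>2"
  have c: "c > 0" "c = S / \<sigma>\<^sup>2" using vg_rate_pos[OF \<theta> \<sigma>] by (auto simp: c_def vg_rate_def S_def)
  have b: "\<beta> < c" "- \<beta> < c"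
    using vg_tilt_less[OF \<theta> \<sigma>] divide_pos_pos[OF \<theta>, of "\<sigma>\<^sup>2"] \<sigma> c(1) unfolding \<beta>_def c_def by auto
  \<comment> \<open>The sum of the two half-line integrals is symmetric in \<open>d\<close> and
    \<open>e\<close>, and both elementary symmetric functions are simple: the sum is 2c and the
    product is 1 / \<sigma>^2.\<close>
  define d e where "d = c - \<beta>" and "e = c + \<beta>"
  have de: "d > 0" "e > 0" "d + e = 2 * c" "d * e = 1 / \<sigma>\<^sup>2"
    using b vg_rate_sq_diff[OF \<theta> \<sigma>] by (auto simp: d_def e_def c_def \<beta>_def algebra_simps power2_eq_square)
  have sum: "1 / d + c / d\<^sup>2 + (1 / e + c / e\<^sup>2) = 4 * c ^ 3 * \<sigma> ^ 4"
  proof -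
    have "1 / d + c / d\<^sup>2 + (1 / e + c / e\<^sup>2) = ((d + e) * (d * e) + c * ((d + e)\<^sup>2 - 2 * (d * e))) / (d * e)\<^sup>2"
      using de(1,2) by (simp add: field_simps power2_eq_square)
    also have "\<dots> = 4 * c ^ 3 / (1 / \<sigma>\<^sup>2)\<^sup>2"
      unfolding de(3,4) by (simp add: power2_eq_square power3_eq_cube algebra_simps)
    also have "\<dots> = 4 * c ^ 3 * \<sigma> ^ 4" using \<sigma> by (simp add: power_divide)
    finally show ?thesis .
  qed
  have const: "vg_const 4 \<theta> \<sigma> = \<sigma>\<^sup>2 / (2 * sqrt 2 * sqrt pi * S ^ 3)"
  proof -
    define u where "u = \<sigma> / (sqrt 2 * S)"
    have u: "u > 0" using \<sigma> S by (simp add: u_def)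
    have "\<sigma>\<^sup>2 / (2 * (\<theta>\<^sup>2 + \<sigma>\<^sup>2)) = u powr 2"
      using u by (simp add: u_def S(2) power_divide power_mult_distrib)
    then have "(\<sigma>\<^sup>2 / (2 * (\<theta>\<^sup>2 + \<sigma>\<^sup>2))) powr ((4 - 1) / 2) = u powr 3"
      by (simp add: powr_powr)
    also have "\<dots> = u ^ 3" using u powr_realpow[of u 3] by simp
    also have "\<dots> = \<sigma> ^ 3 / (2 * sqrt 2 * S ^ 3)"
      by (simp add: u_def power_divide power_mult_distrib power3_eq_cube)
    moreover have "Gamma (4 / 2 :: real) = 1" using Gamma_fact[of 1, where 'a = real] by simp
    ultimately show ?thesis unfolding vg_const_def using \<sigma>
      by (simp add: power2_eq_square power3_eq_cube)
  qed
  have "(\<integral>x. vg_density 4 \<theta> \<sigma> x \<partial>lborel)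
      = vg_const 4 \<theta> \<sigma> * (sqrt (pi / 2) * (1 / d + c / d\<^sup>2) + sqrt (pi / 2) * (1 / e + c / e\<^sup>2))"
    using vg_density_integrals(2)[of 4] vg_half_three_halves_integral[OF c(1) b(1)]
      vg_half_three_halves_integral[OF c(1) b(2)]
    by (simp add: c_def[symmetric] \<beta>_def[symmetric] d_def e_def)
  also have "\<dots> = vg_const 4 \<theta> \<sigma> * (sqrt (pi / 2) * (4 * c ^ 3 * \<sigma> ^ 4))"
    unfolding distrib_left[symmetric] sum ..
  also have "4 * c ^ 3 * \<sigma> ^ 4 = 4 * (S ^ 3 / \<sigma>\<^sup>2)"
    unfolding c(2) using \<sigma> by (simp add: power_divide field_simps eval_nat_numeral)
  also have "vg_const 4 \<theta> \<sigma> * (sqrt (pi / 2) * (4 * (S ^ 3 / \<sigma>\<^sup>2))) = 1"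
    unfolding const real_sqrt_divide using \<sigma> S(1) by (simp add: field_simps)
  finally show ?thesis .
qed

lemma vg_distributed_4_exists: "\<exists>(P :: real measure) X. vg_distributed P X 4 \<theta> \<sigma>"
proof -
  let ?p = "vg_density 4 \<theta> \<sigma>"
  let ?P = "density lborel (\<lambda>x. ennreal (?p x))"
  have int: "integrable lborel ?p" by (rule vg_density_integrals(1)) simp
  then have meas [measurable]: "?p \<in> borel_measurable lborel" by simp
  have "emeasure ?P (space ?P) = (\<integral>\<^sup>+x. ennreal (?p x) \<partial>lborel)"
    by (simp add: emeasure_density)
  also have "\<dots> = ennreal (\<integral>x. ?p x \<partial>lborel)"
    using int vg_density_nonneg[OF \<theta> \<sigma>, of 4] by (intro nn_integral_eq_integral) auto
  finally have "prob_space ?P" unfolding vg_density_4_mass by (intro prob_spaceI) simp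
  moreover have "distributed ?P lborel (\<lambda>x. x) (\<lambda>x. ennreal (?p x))"
    unfolding distributed_def by (auto simp: distr_id2)
  ultimately show ?thesis unfolding vg_distributed_def by blast
qed

end

section \<open>Attained values for r = 4 and \<theta> = 1, and the theorem\<close>

lemma vg_ratio_surj:
  assumes "0 < \<kappa>" "\<kappa> < 1"
  shows "\<exists>\<sigma>>0. vg_ratio 1 \<sigma> = \<kappa>"
proof (intro exI conjI)
  \<comment> \<open>The witness solves 1 / sqrt(1 + \<sigma>^2) = \<kappa> for \<sigma>.\<close>
  have k: "1 / \<kappa>\<^sup>2 - 1 > 0" using assms by (simp add: power_less_one_iff abs_square_less_1)
  then show "sqrt (1 / \<kappa>\<^sup>2 - 1) > 0" by simp
  show "vg_ratio 1 (sqrt (1 / \<kappa>\<^sup>2 - 1)) = \<kappa>"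
    using k assms by (simp add: vg_ratio_def real_sqrt_divide)
qed

lemma vg_mode_4_attained:
  assumes "0 < \<kappa>" "\<kappa> < 1"
  shows "\<exists>\<sigma>>0. vg_mode 4 1 \<sigma> = 1 + \<kappa>"
  using vg_ratio_surj[OF assms] vg_mode_4[of 1] by auto

lemma vg_mean_minus_mode_4_attained:
  assumes "0 < \<kappa>" "\<kappa> < 1"
  shows "\<exists>\<sigma>>0. \<exists>(P :: real measure) X. vg_distributed P X 4 1 \<sigma> \<and>
      prob_space.expectation P X - vg_mode 4 1 \<sigma> = 3 - \<kappa>"
proof -
  obtain \<sigma> where \<sigma>: "\<sigma> > 0" "vg_mode 4 1 \<sigma> = 1 + \<kappa>" using vg_mode_4_attained[OF assms] by blast
  obtain P :: "real measure" and X where X: "vg_distributed P X 4 1 \<sigma>"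
    using vg_distributed_4_exists[of 1 \<sigma>] \<sigma> by auto
  have "prob_space.expectation P X - vg_mode 4 1 \<sigma> = 3 - \<kappa>"
    using vg_expectation[OF _ \<sigma>(1) _ X] \<sigma>(2) by simp
  with X \<sigma> show ?thesis by blast
qed

theorem corollary2p6:
  "(\<forall>r \<theta> \<sigma> :: real. r > 0 \<longrightarrow> \<theta> > 0 \<longrightarrow> \<sigma> > 0 \<longrightarrow>
      (r \<le> 2 \<longrightarrow> vg_mode r \<theta> \<sigma> = 0) \<and>
      (r > 2 \<longrightarrow>
         vg_mode r \<theta> \<sigma> > 0 \<and>
         \<theta> * (r - 3) < vg_mode r \<theta> \<sigma> \<and> vg_mode r \<theta> \<sigma> < \<theta> * (r - 2) \<and>
         (\<forall>(P :: 'a measure) X. vg_distributed P X r \<theta> \<sigma> \<longrightarrow>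
            2 * \<theta> < prob_space.expectation P X - vg_mode r \<theta> \<sigma> \<and>
            prob_space.expectation P X - vg_mode r \<theta> \<sigma> < 3 * \<theta>)) \<and>
      (r > 4 \<longrightarrow>
         vg_mode r \<theta> \<sigma> > vg_mode_bound r \<theta> \<sigma> \<and>
         vg_mode_bound r \<theta> \<sigma> > \<theta> * (r - 3)) \<and>
      (r = 4 \<longrightarrow> vg_mode r \<theta> \<sigma> = vg_mode_bound r \<theta> \<sigma>) \<and>
      (2 < r \<and> r < 4 \<longrightarrow> vg_mode r \<theta> \<sigma> < vg_mode_bound r \<theta> \<sigma>) \<and>
      (3 < r \<and> r < 4 \<longrightarrow> vg_mode_bound r \<theta> \<sigma> < \<theta> * (r - 2)) \<and>
      (2 < r \<and> r < 3 \<longrightarrow> vg_mode_bound r \<theta> \<sigma> > \<theta> * (r - 2))) \<and>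
   (\<forall>a<3. \<not> (\<forall>r>2. \<forall>\<theta>>0. \<forall>\<sigma>>0. \<theta> * (r - a) \<le> vg_mode r \<theta> \<sigma>)) \<and>
   (\<forall>a>2. \<not> (\<forall>r>2. \<forall>\<theta>>0. \<forall>\<sigma>>0. vg_mode r \<theta> \<sigma> \<le> \<theta> * (r - a))) \<and>
   (\<forall>b>2. \<not> (\<forall>r>2. \<forall>\<theta>>0. \<forall>\<sigma>>0. \<forall>(P :: real measure) X. vg_distributed P X r \<theta> \<sigma> \<longrightarrow>
            b * \<theta> \<le> prob_space.expectation P X - vg_mode r \<theta> \<sigma>)) \<and>
   (\<forall>b<3. \<not> (\<forall>r>2. \<forall>\<theta>>0. \<forall>\<sigma>>0. \<forall>(P :: real measure) X. vg_distributed P X r \<theta> \<sigma> \<longrightarrow>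
            prob_space.expectation P X - vg_mode r \<theta> \<sigma> \<le> b * \<theta>))"
proof (intro conjI allI impI)
  fix r \<theta> \<sigma> :: real
  assume r: "r > 0" and pos: "\<theta> > 0" "\<sigma> > 0"
  show "r \<le> 2 \<Longrightarrow> vg_mode r \<theta> \<sigma> = 0" by (rule vg_mode_eq_0[OF pos r])
  show "r > 2 \<Longrightarrow> vg_mode r \<theta> \<sigma> > 0" by (rule vg_mode_root(1)[OF pos r])
  show low: "r > 2 \<Longrightarrow> \<theta> * (r - 3) < vg_mode r \<theta> \<sigma>" by (rule vg_mode_bounds(2)[OF pos r])
  show upp: "r > 2 \<Longrightarrow> vg_mode r \<theta> \<sigma> < \<theta> * (r - 2)" by (rule vg_mode_bounds(1)[OF pos r])
  fix P :: "'a measure" and X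
  assume r2: "r > 2" and X: "vg_distributed P X r \<theta> \<sigma>"
  show "2 * \<theta> < prob_space.expectation P X - vg_mode r \<theta> \<sigma>"
    "prob_space.expectation P X - vg_mode r \<theta> \<sigma> < 3 * \<theta>"
    unfolding vg_expectation[OF pos r2 X] using low[OF r2] upp[OF r2] by (simp_all add: algebra_simps)
next
  fix r \<theta> \<sigma> :: real
  assume r: "r > 0" and pos: "\<theta> > 0" "\<sigma> > 0"
  show "r > 4 \<Longrightarrow> vg_mode_bound r \<theta> \<sigma> < vg_mode r \<theta> \<sigma>" using vg_mode_bounds(3)[OF pos r] by simp
  show "r = 4 \<Longrightarrow> vg_mode r \<theta> \<sigma> = vg_mode_bound r \<theta> \<sigma>" using vg_mode_bounds(4)[OF pos r] by simp
  show "2 < r \<and> r < 4 \<Longrightarrow> vg_mode r \<theta> \<sigma> < vg_mode_bound r \<theta> \<sigma>" using vg_mode_bounds(5)[OF pos r] by simp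
  show "r > 4 \<Longrightarrow> \<theta> * (r - 3) < vg_mode_bound r \<theta> \<sigma>" by (rule vg_mode_bound_compare(1)[OF pos])
  show "3 < r \<and> r < 4 \<Longrightarrow> vg_mode_bound r \<theta> \<sigma> < \<theta> * (r - 2)" using vg_mode_bound_compare(2)[OF pos] by simp
  show "2 < r \<and> r < 3 \<Longrightarrow> \<theta> * (r - 2) < vg_mode_bound r \<theta> \<sigma>" using vg_mode_bound_compare(3)[OF pos] by simp
next
  fix a :: real assume a: "a < 3"
  \<comment> \<open>For r = 4 and \<theta> = 1 the supposed bound says 4 - a \<le> 1 + k. Any
    positive k below 3 - a refutes it; the value 1/2 keeps k below 1.\<close>
  define k where "k = min (1/2) ((3 - a) / 2)"
  have k: "0 < k" "k < 1" "k < 3 - a" using a by (auto simp: k_def min_def)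
  obtain \<sigma> where \<sigma>: "\<sigma> > 0" "vg_mode 4 1 \<sigma> = 1 + k" using vg_mode_4_attained[OF k(1,2)] by blast
  show "\<not> (\<forall>r>2. \<forall>\<theta>>0. \<forall>\<sigma>>0. \<theta> * (r - a) \<le> vg_mode r \<theta> \<sigma>)"
  proof
    assume "\<forall>r>2. \<forall>\<theta>>0. \<forall>\<sigma>>0. \<theta> * (r - a) \<le> vg_mode r \<theta> \<sigma>"
    from this[rule_format, of 4 1 \<sigma>] show False using \<sigma> k by simp
  qed
next
  fix a :: real assume a: "a > 2"
  \<comment> \<open>Here 1 + k must exceed 4 - a, so k is taken close to 1; the value 1/2 keeps it
    positive for large a.\<close>
  define k where "k = max (1/2) (1 - (a - 2) / 2)"
  have k: "0 < k" "k < 1" "k > 3 - a" using a by (auto simp: k_def max_def field_simps)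
  obtain \<sigma> where \<sigma>: "\<sigma> > 0" "vg_mode 4 1 \<sigma> = 1 + k" using vg_mode_4_attained[OF k(1,2)] by blast
  show "\<not> (\<forall>r>2. \<forall>\<theta>>0. \<forall>\<sigma>>0. vg_mode r \<theta> \<sigma> \<le> \<theta> * (r - a))"
  proof
    assume "\<forall>r>2. \<forall>\<theta>>0. \<forall>\<sigma>>0. vg_mode r \<theta> \<sigma> \<le> \<theta> * (r - a)"
    from this[rule_format, of 4 1 \<sigma>] show False using \<sigma> k by simp
  qed
next
  fix b :: real assume b: "b > 2"
  \<comment> \<open>The difference 3 - k between mean and mode must fall below b, which again needs
    k close to 1.\<close>
  define k where "k = max (1/2) (1 - (b - 2) / 2)"
  have k: "0 < k" "k < 1" "k > 3 - b" using b by (auto simp: k_def max_def field_simps)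
  obtain \<sigma> and P :: "real measure" and X where \<sigma>: "\<sigma> > 0" and X: "vg_distributed P X 4 1 \<sigma>"
    and eq: "prob_space.expectation P X - vg_mode 4 1 \<sigma> = 3 - k"
    using vg_mean_minus_mode_4_attained[OF k(1,2)] by blast
  show "\<not> (\<forall>r>2. \<forall>\<theta>>0. \<forall>\<sigma>>0. \<forall>(P :: real measure) X. vg_distributed P X r \<theta> \<sigma> \<longrightarrow>
            b * \<theta> \<le> prob_space.expectation P X - vg_mode r \<theta> \<sigma>)"
  proof
    assume "\<forall>r>2. \<forall>\<theta>>0. \<forall>\<sigma>>0. \<forall>(P :: real measure) X. vg_distributed P X r \<theta> \<sigma> \<longrightarrow>
            b * \<theta> \<le> prob_space.expectation P X - vg_mode r \<theta> \<sigma>"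
    from this[rule_format, of 4 1 \<sigma> P X] show False using \<sigma> X eq k by simp
  qed
next
  fix b :: real assume b: "b < 3"
  \<comment> \<open>Now 3 - k must exceed b, so k is taken close to 0.\<close>
  define k where "k = min (1/2) ((3 - b) / 2)"
  have k: "0 < k" "k < 1" "k < 3 - b" using b by (auto simp: k_def min_def)
  obtain \<sigma> and P :: "real measure" and X where \<sigma>: "\<sigma> > 0" and X: "vg_distributed P X 4 1 \<sigma>"
    and eq: "prob_space.expectation P X - vg_mode 4 1 \<sigma> = 3 - k"
    using vg_mean_minus_mode_4_attained[OF k(1,2)] by blast
  show "\<not> (\<forall>r>2. \<forall>\<theta>>0. \<forall>\<sigma>>0. \<forall>(P :: real measure) X. vg_distributed P X r \<theta> \<sigma> \<longrightarrow>
            prob_space.expectation P X - vg_mode r \<theta> \<sigma> \<le> b * \<theta>)"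
  proof
    assume "\<forall>r>2. \<forall>\<theta>>0. \<forall>\<sigma>>0. \<forall>(P :: real measure) X. vg_distributed P X r \<theta> \<sigma> \<longrightarrow>
            prob_space.expectation P X - vg_mode r \<theta> \<sigma> \<le> b * \<theta>"
    from this[rule_format, of 4 1 \<sigma> P X] show False using \<sigma> X eq k by simp
  qed
qed

end
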